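(* Let $\Omega$ be a bounded domain of $\mathbb{R}^2$ with $C^1$ smooth boundary. Consider a $p$-minimal graph over $\bar\Omega$ defined by $u\in C^1(\bar\Omega)$. Suppose $\Omega$ is convex and $S(u)\subset\subset\Omega$ and $S(u)$ is nonempty. Then $\#\,\pi_0(S(u))=1$, i.e. $S(u)$ has exactly one connected component.
   Context: Let $\vec F=(-y,x)$. $S(u)$ is the set of points of $\bar\Omega$ (singular points) where $\nabla u+\vec F=(u_x-y,u_y+x)=0$. The graph of $u$ is a ($C^1$ smooth) $p$-minimal graph if $u$ is a weak solution of $\operatorname{div}\frac{\nabla u+\vec F}{|\nabla u+\vec F|}=0$ in $\Omega$, i.e. for every $\varphi\in C_0^\infty(\Omega)$ $$\int_{S(u)\cap\Omega}|\nabla\varphi|+\int_{\Omega\setminus S(u)}\frac{\nabla u+\vec F}{|\nabla u+\vec F|}\cdot\nabla\varphi\ge0 .$$ $S(u)\subset\subset\Omega$ means $S(u)$ is a compact subset of $\Omega$ (so there are no singular points on $\partial\Omega$). *)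

theory Defs
  imports "HOL-Analysis.Analysis"
begin

definition domain2 :: "(real^2) set \<Rightarrow> bool" where
  "domain2 \<Omega> \<longleftrightarrow> open \<Omega> \<and> connected \<Omega> \<and> \<Omega> \<noteq> {}"

text \<open>Near every boundary point, and in a suitable orthonormal frame \<open>a\<close>, \<open>b\<close>, the set is the
  region strictly above the graph of a \<open>C\<^sup>1\<close> function.\<close>
definition C1_boundary :: "(real^2) set \<Rightarrow> bool" where
  "C1_boundary \<Omega> \<longleftrightarrow> (\<forall>p\<in>frontier \<Omega>. \<exists>r>0. \<exists>a b. \<exists>\<gamma>::real \<Rightarrow> real.
     norm a = 1 \<and> norm b = 1 \<and> a \<bullet> b = 0 \<and> \<gamma> C1_differentiable_on UNIV \<and>
     \<Omega> \<inter> ball p r = {x \<in> ball p r. \<gamma> (x \<bullet> a) < x \<bullet> b})"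

text \<open>The vector of partial derivatives, meaningful at points of differentiability.\<close>
definition grad :: "(real^2 \<Rightarrow> real) \<Rightarrow> real^2 \<Rightarrow> real^2" where
  "grad u x = (\<chi> i. frechet_derivative u (at x) (axis i 1))"

text \<open>\<open>u \<in> C\<^sup>1\<close> of the closure of the open set \<open>\<Omega>\<close>: \<open>u\<close> is continuous up to the boundary,
  differentiable inside, and its gradient extends continuously to the closure.
  Values of \<open>u\<close> outside the closure play no role.\<close>
definition C1_closure :: "(real^2) set \<Rightarrow> (real^2 \<Rightarrow> real) \<Rightarrow> bool" where
  "C1_closure \<Omega> u \<longleftrightarrow> continuous_on (closure \<Omega>) u \<and>
     (\<forall>x\<in>\<Omega>. u differentiable (at x)) \<and>
     (\<exists>g. continuous_on (closure \<Omega>) g \<and> (\<forall>x\<in>\<Omega>. g x = grad u x))"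

text \<open>The gradient up to the boundary, i.e. the continuous extension \<open>g\<close> of the previous
  definition: on \<open>\<Omega>\<close> itself the limit is \<open>grad u x\<close>.\<close>
definition grad_cl :: "(real^2) set \<Rightarrow> (real^2 \<Rightarrow> real) \<Rightarrow> real^2 \<Rightarrow> real^2" where
  "grad_cl \<Omega> u x = Lim (at x within \<Omega>) (grad u)"

definition vecF :: "real^2 \<Rightarrow> real^2" where
  "vecF x = vector [- x$2, x$1]"

definition sing_set :: "(real^2) set \<Rightarrow> (real^2 \<Rightarrow> real) \<Rightarrow> (real^2) set" where
  "sing_set \<Omega> u = {x \<in> closure \<Omega>. grad_cl \<Omega> u x + vecF x = 0}"

fun Ck :: "nat \<Rightarrow> (real^2 \<Rightarrow> real) \<Rightarrow> bool" where
  "Ck 0 f \<longleftrightarrow> continuous_on UNIV f"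
| "Ck (Suc k) f \<longleftrightarrow> (\<forall>x. f differentiable (at x)) \<and>
     (\<forall>i. Ck k (\<lambda>x. grad f x $ i))"

text \<open>Elements of \<open>C\<^sub>0\<^sup>\<infinity>(\<Omega>)\<close>, extended by zero to the whole plane.\<close>
definition test_function :: "(real^2) set \<Rightarrow> (real^2 \<Rightarrow> real) \<Rightarrow> bool" where
  "test_function \<Omega> \<phi> \<longleftrightarrow> (\<forall>k. Ck k \<phi>) \<and>
     compact (closure {x. \<phi> x \<noteq> 0}) \<and> closure {x. \<phi> x \<noteq> 0} \<subseteq> \<Omega>"

definition p_minimal_graph :: "(real^2) set \<Rightarrow> (real^2 \<Rightarrow> real) \<Rightarrow> bool" where
  "p_minimal_graph \<Omega> u \<longleftrightarrow> (\<forall>\<phi>. test_function \<Omega> \<phi> \<longrightarrow>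
     (LINT x:(sing_set \<Omega> u \<inter> \<Omega>)|lborel. norm (grad \<phi> x)) +
     (LINT x:(\<Omega> - sing_set \<Omega> u)|lborel.
        ((1 / norm (grad u x + vecF x)) *\<^sub>R (grad u x + vecF x)) \<bullet> grad \<phi> x) \<ge> 0)"

end

theory Submission
  imports Defs "HOL-Computational_Algebra.Polynomial"
begin

text \<open>Write \<open>J = vecF\<close> for the rotation by a right angle and \<open>V = \<nabla>u + vecF\<close>, let \<open>U\<close> be the part of
  \<open>\<Omega>\<close> outside the singular set \<open>S\<close>, and let \<open>N = V/|V|\<close> on \<open>U\<close>. The weak equation says that \<open>N\<close> is
  divergence free in \<open>U\<close>; locally \<open>e = -JN\<close> is therefore the gradient of a \<open>C\<^sup>1\<close> function, which
  solves the eikonal equation, and so \<open>e\<close> is constant along the straight lines with direction \<open>e\<close>.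

  On such a characteristic line \<open>u\<close> is affine. Comparing two neighbouring lines, which do not
  cross in \<open>U\<close>, one finds \<open>|V(x + te)| (1 + kt) = |V(x)| + 2t + kt\<^sup>2\<close> with \<open>1 + kt > 0\<close>. This has three
  consequences: a line can hit \<open>S\<close> only in the direction \<open>-e\<close>; if it does, \<open>|V|\<close> dominates the
  distance to the point of impact; and \<open>|V(x)| \<ge> \<delta>\<close> if the line stays in \<open>U\<close> for the length \<open>\<delta>\<close>
  on both sides of \<open>x\<close>, so that near \<open>S\<close> all lines hit \<open>S\<close>.

  If \<open>S\<close> were the union of two disjoint nonempty closed sets \<open>A\<close> and \<open>B\<close>, then the points whose line
  hits \<open>A\<close> would form a relatively open and closed part of \<open>U\<close>, and likewise for \<open>B\<close>. These two parts
  are disjoint. Following a line in the direction \<open>e\<close> one reaches the boundary of \<open>\<Omega>\<close>, so both parts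
  meet the connected set \<open>\<Omega> - convex hull S\<close>, a contradiction.\<close>


section \<open>Smooth cut-off functions on the line\<close>

text \<open>The derivative enters as an existential witness, so closure under sums, products and
  affine substitutions is proved by writing down the differentiated formula and applying the
  induction hypothesis to it.\<close>

primrec kdiff :: "nat \<Rightarrow> (real \<Rightarrow> real) \<Rightarrow> bool" where
  "kdiff 0 f \<longleftrightarrow> continuous_on UNIV f"
| "kdiff (Suc k) f \<longleftrightarrow> (\<exists>f'. (\<forall>x. (f has_real_derivative f' x) (at x)) \<and> kdiff k f')"

definition smooth :: "(real \<Rightarrow> real) \<Rightarrow> bool" where
  "smooth f \<longleftrightarrow> (\<forall>k. kdiff k f)"

lemma kdiff_imp_continuous: "kdiff k f \<Longrightarrow> continuous_on UNIV f"
  by (cases k) (auto simp: continuous_on_eq_continuous_at intro: DERIV_isCont)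

lemma kdiff_Suc_imp: "kdiff (Suc k) f \<Longrightarrow> kdiff k f"
proof (induction k arbitrary: f)
  case 0
  then show ?case using kdiff_imp_continuous by (metis kdiff.simps(1))
next
  case (Suc k)
  from Suc.prems obtain f' where "\<forall>x. (f has_real_derivative f' x) (at x)" "kdiff (Suc k) f'"
    using kdiff.simps(2)[of "Suc k" f] by blast
  with Suc.IH show ?case by auto
qed

lemma kdiff_const: "kdiff k (\<lambda>x. c)"
proof (induction k arbitrary: c)
  case (Suc k)
  then show ?case by (auto intro!: exI[of _ "\<lambda>x. 0"] derivative_eq_intros)
qed auto

lemma kdiff_add: "kdiff k f \<Longrightarrow> kdiff k g \<Longrightarrow> kdiff k (\<lambda>x. f x + g x)"
proof (induction k arbitrary: f g)
  case (Suc k)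
  then obtain f' g' where "\<forall>x. (f has_real_derivative f' x) (at x)" "kdiff k f'"
    "\<forall>x. (g has_real_derivative g' x) (at x)" "kdiff k g'" by auto
  then show ?case using Suc.IH by (auto intro!: exI[of _ "\<lambda>x. f' x + g' x"] derivative_eq_intros)
qed (auto intro: continuous_intros)

lemma kdiff_mult: "kdiff k f \<Longrightarrow> kdiff k g \<Longrightarrow> kdiff k (\<lambda>x. f x * g x)"
proof (induction k arbitrary: f g)
  case (Suc k)
  then obtain f' g' where fg: "\<forall>x. (f has_real_derivative f' x) (at x)" "kdiff k f'"
    "\<forall>x. (g has_real_derivative g' x) (at x)" "kdiff k g'" by auto
  have "kdiff k f" "kdiff k g" using Suc.prems kdiff_Suc_imp by blast+
  then have "kdiff k (\<lambda>x. f' x * g x + f x * g' x)"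
    using fg Suc.IH by (intro kdiff_add) auto
  then show ?case using fg
    by (auto intro!: exI[of _ "\<lambda>x. f' x * g x + f x * g' x"] derivative_eq_intros)
qed (auto intro: continuous_intros)

lemma kdiff_affine: "kdiff k f \<Longrightarrow> kdiff k (\<lambda>x. f (c * x + d))"
proof (induction k arbitrary: f)
  case 0
  then show ?case by (auto intro!: continuous_on_compose2[of UNIV f] continuous_intros)
next
  case (Suc k)
  then obtain f' where f: "\<forall>x. (f has_real_derivative f' x) (at x)" "kdiff k f'" by auto
  have "((\<lambda>x. f (c * x + d)) has_real_derivative c * f' (c * x + d)) (at x)" for x
    by (rule DERIV_chain2[THEN DERIV_cong, OF f(1)[rule_format]])
      (auto intro!: derivative_eq_intros)
  moreover have "kdiff k (\<lambda>x. c * f' (c * x + d))"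
    by (intro kdiff_mult kdiff_const Suc.IH f(2))
  ultimately show ?case unfolding kdiff.simps by (intro exI[of _ "\<lambda>x. c * f' (c * x + d)"]) blast
qed

lemma smooth_antiderivative:
  assumes "\<And>x. (f has_real_derivative f' x) (at x)" "smooth f'"
  shows "smooth f"
  unfolding smooth_def
proof
  fix k show "kdiff k f"
    \<comment> \<open>Proving the order \<open>Suc k\<close> and dropping back to \<open>k\<close>
      treats \<open>k = 0\<close> together with all other orders.\<close>
    by (rule kdiff_Suc_imp) (use assms in \<open>auto simp: smooth_def\<close>)
qed

lemma smooth_derivative:
  assumes "\<And>x. (f has_real_derivative f' x) (at x)" "smooth f"
  shows "smooth f'"
  unfolding smooth_def
proof
  fix k
  have "kdiff (Suc k) f" using assms(2) unfolding smooth_def by blast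
  then obtain f'' where "\<forall>x. (f has_real_derivative f'' x) (at x)" "kdiff k f''"
    by auto
  moreover from this assms(1) have "f'' = f'" by (metis DERIV_unique ext)
  ultimately show "kdiff k f'" by simp
qed

lemma smooth_mult: "smooth f \<Longrightarrow> smooth g \<Longrightarrow> smooth (\<lambda>x. f x * g x)"
  and smooth_add: "smooth f \<Longrightarrow> smooth g \<Longrightarrow> smooth (\<lambda>x. f x + g x)"
  and smooth_const: "smooth (\<lambda>x. c)"
  and smooth_affine: "smooth f \<Longrightarrow> smooth (\<lambda>x. f (c * x + d))"
  by (auto simp: smooth_def kdiff_mult kdiff_add kdiff_const kdiff_affine)

lemma smooth_continuous: "smooth f \<Longrightarrow> continuous_on UNIV f"
  unfolding smooth_def by (metis kdiff.simps(1))

section \<open>Flat functions built from exp(-1/x), and a smooth step\<close>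

definition flat :: "real poly \<Rightarrow> real \<Rightarrow> real" where
  "flat p x = (if x > 0 then poly p (1/x) * exp (- (1/x)) else 0)"

text \<open>The factor \<open>y ^ k\<close> is what the induction over the coefficients requires:
  splitting off the constant coefficient of \<open>pCons a p\<close> leaves \<open>p\<close> with
  the power raised by one.\<close>

lemma poly_over_exp_tendsto_0: "((\<lambda>y. y ^ k * poly p y / exp y) \<longlongrightarrow> (0::real)) at_top"
proof (induction p arbitrary: k)
  case (pCons a p)
  have "((\<lambda>y. a * (y ^ k / exp y) + y ^ Suc k * poly p y / exp y) \<longlongrightarrow> a * 0 + 0) at_top"
    by (intro tendsto_intros tendsto_power_div_exp_0 pCons.IH)
  then show ?case by (simp add: algebra_simps add_divide_distrib)
qed auto

text \<open>For x > 0 differentiating p(1/x) exp(-1/x) produces the factor 1/x^2, which is the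
  polynomial \<open>[:0,0,1:]\<close> at 1/x, times p - p' at 1/x. The family \<open>flat\<close> is
  therefore closed under differentiation, and this gives smoothness at once for all its
  members.\<close>

lemma flat_has_derivative:
  "(flat p has_real_derivative flat ([:0,0,1:] * (p - pderiv p)) x) (at x)"
proof -
  consider "x > 0" | "x < 0" | "x = 0" by linarith
  then show ?thesis
  proof cases
    case 1
    have "((\<lambda>x. poly p (1/x) * exp (- (1/x))) has_real_derivative
        flat ([:0,0,1:] * (p - pderiv p)) x) (at x)"
      using 1 by (auto intro!: derivative_eq_intros poly_DERIV[THEN DERIV_chain2]
          simp: flat_def field_simps power2_eq_square)
    moreover have "\<forall>\<^sub>F y in nhds x. flat p y = poly p (1/y) * exp (- (1/y))"
      using eventually_nhds_in_open[of "{0<..}" x] 1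
      by (auto simp: flat_def elim: eventually_mono)
    ultimately show ?thesis by (subst DERIV_cong_ev[OF refl _ refl])
  next
    case 2
    have "\<forall>\<^sub>F y in nhds x. flat p y = 0"
      using eventually_nhds_in_open[of "{..<0}" x] 2
      by (auto simp: flat_def elim: eventually_mono)
    then show ?thesis using 2 by (simp add: flat_def cong: DERIV_cong_ev)
  next
    case 3
    have "((\<lambda>h. flat p h / h) \<longlongrightarrow> 0) (at_right 0)"
    proof -
      \<comment> \<open>With y = 1/h the right difference quotient at 0 becomes y p(y) / exp y, and
        h tending to 0 from the right means y tending to infinity.\<close>
      have "((\<lambda>h. (\<lambda>y. y ^ 1 * poly p y / exp y) (inverse h)) \<longlongrightarrow> 0) (at_right 0)"
        by (rule filterlim_compose[OF poly_over_exp_tendsto_0 filterlim_inverse_at_top_right])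
      moreover have "\<forall>\<^sub>F h in at_right 0. (\<lambda>y. y ^ 1 * poly p y / exp y) (inverse h) = flat p h / h"
        using eventually_at_right_less[of "0::real"]
        by eventually_elim (auto simp: flat_def field_simps exp_minus inverse_eq_divide)
      ultimately show ?thesis by (rule Lim_transform_eventually)
    qed
    moreover have "((\<lambda>h. flat p h / h) \<longlongrightarrow> 0) (at_left 0)"
      by (rule tendsto_eventually)
        (auto simp: flat_def eventually_at_left_field intro!: exI[of _ "-1"])
    ultimately have "((\<lambda>h. flat p h / h) \<longlongrightarrow> 0) (at 0)" by (simp add: filterlim_at_split)
    then show ?thesis using 3 by (simp add: DERIV_def flat_def)
  qed
qed

lemma smooth_flat: "smooth (flat p)"
  unfolding smooth_def
proof
  fix k show "kdiff k (flat p)"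
  proof (induction k arbitrary: p)
    case 0
    have "continuous_on UNIV (flat p)"
      by (rule DERIV_continuous_on) (use flat_has_derivative has_field_derivative_at_within in blast)
    then show ?case by simp
  next
    case (Suc k)
    then show ?case using flat_has_derivative by auto
  qed
qed

text \<open>\<open>H\<close> is a primitive of a bump on [0,1], normalised to rise from 0 to 1.
  Rescaled copies of \<open>H\<close> approximate indicators, and rescaled copies of
  \<open>h\<close> approximate a unit point mass.\<close>

lemma smooth_step:
  obtains H h :: "real \<Rightarrow> real" where
    "smooth h" "\<And>x. (H has_real_derivative h x) (at x)" "\<And>x. x \<le> 0 \<Longrightarrow> H x = 0"
    "\<And>x. 1 \<le> x \<Longrightarrow> H x = 1" "\<And>x. 0 \<le> h x" "\<And>x. x \<le> 0 \<or> 1 \<le> x \<Longrightarrow> h x = 0"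
proof -
  \<comment> \<open>A bump that is positive exactly on the open interval (0,1).\<close>
  define b where "b = (\<lambda>x. flat 1 x * flat 1 (1 - x))"
  have sb: "smooth b"
    using smooth_mult[OF smooth_flat smooth_affine[OF smooth_flat, of 1 "-1" 1]]
    by (simp add: b_def)
  have b0: "0 \<le> b x" "x \<le> 0 \<or> 1 \<le> x \<Longrightarrow> b x = 0" "0 < x \<Longrightarrow> x < 1 \<Longrightarrow> 0 < b x" for x
    by (auto simp: b_def flat_def)
  have "continuous_on UNIV b" by (rule smooth_continuous[OF sb])
  then obtain G where G: "\<And>x. (G has_vector_derivative b x) (at x)"
    using einterval_antiderivative[of "-\<infinity>" "\<infinity>" b]
    by (auto simp: continuous_on_eq_continuous_at)
  then have G: "(G has_real_derivative b x) (at x)" for x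
    by (simp add: has_real_derivative_iff_has_vector_derivative)
  have G_le: "G x = G 0" if "x \<le> 0" for x
  proof (cases "x = 0")
    case False
    then have "x < 0" using that by simp
    have "\<exists>z. x < z \<and> z < 0 \<and> G 0 - G x = (0 - x) * b z"
      by (rule MVT2[OF \<open>x < 0\<close>]) (rule G)
    then show ?thesis using b0(2) by auto
  qed auto
  have G_ge: "G x = G 1" if "1 \<le> x" for x
  proof (cases "x = 1")
    case False
    then have "1 < x" using that by simp
    have "\<exists>z. 1 < z \<and> z < x \<and> G x - G 1 = (x - 1) * b z"
      by (rule MVT2[OF \<open>1 < x\<close>]) (rule G)
    then show ?thesis using b0(2) by auto
  qed auto
  have "\<exists>z. 0 < z \<and> z < 1 \<and> G 1 - G 0 = (1 - 0) * b z"
    by (rule MVT2) (auto intro: G)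
  then have c: "G 1 - G 0 > 0" using b0(3) by (metis diff_zero mult_1)
  \<comment> \<open>The normalisation that gives the bump total mass 1; the mean value theorem has
    just shown that its mass is positive.\<close>
  define c where "c = 1 / (G 1 - G 0)"
  have cp: "c > 0" "c * (G 1 - G 0) = 1" using c by (auto simp: c_def)
  show thesis
  proof (rule that[of "\<lambda>x. c * b x" "\<lambda>x. c * (G x - G 0)"])
    show "smooth (\<lambda>x. c * b x)" by (intro smooth_mult smooth_const sb)
    show "((\<lambda>x. c * (G x - G 0)) has_real_derivative c * b x) (at x)" for x
      by (auto intro!: derivative_eq_intros G)
    show "c * (G x - G 0) = 0" if "x \<le> 0" for x using G_le[OF that] by simp
    show "c * (G x - G 0) = 1" if "1 \<le> x" for x using G_ge[OF that] cp(2) by simp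
  qed (use cp b0 in auto)
qed

section \<open>Rectangle fluxes and local potentials\<close>

text \<open>The first factor of the weight tends to a unit mass at \<open>x0\<close>, the second to
  the indicator of the interval from \<open>y0\<close> to \<open>y1\<close>. The area integral thus
  collapses to a line integral over a vertical side. Fubini and the substitution x = x0 + s/(n+1)
  reduce the claim to two applications of dominated convergence.\<close>

lemma flux_limit:
  fixes f :: "real \<times> real \<Rightarrow> real" and H h :: "real \<Rightarrow> real"
  assumes f: "continuous_on (cbox (A,C) (B,D)) f" and x0: "A < x0" "x0 < B"
    and y: "C < y0" "y0 \<le> y1" "y1 < D"
    and h: "continuous_on UNIV h" "\<And>x. 0 \<le> h x" "\<And>x. x \<le> 0 \<or> 1 \<le> x \<Longrightarrow> h x = 0"
    and H: "\<And>x. (H has_real_derivative h x) (at x)"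
      "\<And>x. x \<le> 0 \<Longrightarrow> H x = 0" "\<And>x. 1 \<le> x \<Longrightarrow> H x = 1"
  shows "(\<lambda>n. LINT z|lborel. indicator (cbox (A,C) (B,D)) z * f z *
      (real (Suc n) * h (real (Suc n) * (fst z - x0)) *
        (H (real (Suc n) * (snd z - y0)) - H (real (Suc n) * (snd z - y1)))))
    \<longlonglongrightarrow> integral {y0..y1} (\<lambda>y. f (x0, y))"
proof -
  define Q where "Q = cbox (A,C) (B,D)"
  define g where "g = (\<lambda>z. indicator Q z * f z)"
  define b where "b = (\<lambda>n y. H (real (Suc n) * (y - y0)) - H (real (Suc n) * (y - y1)))"
  \<comment> \<open>The inner integral after that substitution; \<open>g\<close> extends
    \<open>f\<close> by zero outside the box, so it is defined and bounded for every
    \<open>s\<close>.\<close>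
  define i where "i = (\<lambda>n y. LINT s|lborel. g (x0 + s / real (Suc n), y) * h s)"
  have Q: "compact Q" unfolding Q_def by (rule compact_cbox)
  have fQ: "continuous_on Q f" using f by (simp add: Q_def)
  have gI: "integrable lborel g"
    using borel_integrable_compact[OF Q fQ] by (simp add: g_def)
  then have gm [measurable]: "g \<in> borel_measurable borel" by auto
  obtain M where M: "\<And>z. \<bar>g z\<bar> \<le> M" "M \<ge> 0"
  proof -
    have "bounded (f ` Q)" using Q fQ compact_continuous_image compact_imp_bounded by blast
    then obtain M where "\<forall>z\<in>Q. \<bar>f z\<bar> \<le> M" by (auto simp: bounded_iff)
    then show thesis by (intro that[of "max M 0"]) (auto simp: g_def indicator_def max_def)
  qed
  have Hc: "continuous_on UNIV H"
    using H(1) by (auto simp: continuous_on_eq_continuous_at intro: DERIV_isCont)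
  have hm [measurable]: "h \<in> borel_measurable borel" using h(1) by (rule borel_measurable_continuous_onI)
  have Hm [measurable]: "H \<in> borel_measurable borel" using Hc by (rule borel_measurable_continuous_onI)
  have h_eq: "h = (\<lambda>x. indicator {0..1} x *\<^sub>R h x)"
  proof
    fix x show "h x = indicator {0..1} x *\<^sub>R h x"
      using h(3)[of x] by (cases "x \<le> 0 \<or> 1 \<le> x") auto
  qed
  have hI: "integrable lborel h"
    using borel_integrable_compact[of "{0..1}" h] h(1) continuous_on_subset
    by (subst h_eq) blast
  have "(LINT x|lborel. h x * indicator {0..1} x) = H 1 - H 0"
    using H(1) h(1) by (intro integral_FTC_Icc_real) (auto simp: continuous_on_eq_continuous_at)
  then have h1: "(LINT x|lborel. h x) = 1"
    using H(2,3) by (subst h_eq) (simp add: mult.commute)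
  have H01: "0 \<le> H x" "H x \<le> 1" for x
  proof -
    have mono: "H a \<le> H b" if "a \<le> b" for a b
      by (rule DERIV_nonneg_imp_nondecreasing[OF that]) (use H(1) h(2) in blast)
    show "0 \<le> H x" using mono[of "min x 0" x] H(2)[of "min x 0"] by simp
    show "H x \<le> 1" using mono[of x "max x 1"] H(3)[of "max x 1"] by simp
  qed
  have b_bd: "\<bar>b n t\<bar> \<le> 1" for n t
    using H01[of "real (Suc n) * (t - y0)"] H01[of "real (Suc n) * (t - y1)"]
    unfolding b_def by linarith
  have b0: "b n t = 0" if "t \<le> y0" for n t
    using that y by (auto simp: b_def H(2) mult_nonneg_nonpos)
  have b2: "b n t = 0" if "1 \<le> real (Suc n) * (t - y1)" for n t
  proof -
    have "real (Suc n) * (t - y1) \<le> real (Suc n) * (t - y0)"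
      using y by (intro mult_left_mono) auto
    then have "H (real (Suc n) * (t - y0)) = 1" "H (real (Suc n) * (t - y1)) = 1"
      using that by (intro H(3); linarith)+
    then show ?thesis by (simp add: b_def)
  qed
  have bm [measurable]: "b n \<in> borel_measurable borel" for n unfolding b_def by measurable
  have large: "\<forall>\<^sub>F n in sequentially. 1 \<le> real (Suc n) * d" if "d > 0" for d
  proof -
    have "filterlim (\<lambda>n. real (Suc n) * d) at_top sequentially"
      by (rule filterlim_at_top_mult_tendsto_pos[OF tendsto_const that])
        (rule filterlim_compose[OF filterlim_real_sequentially filterlim_Suc])
    then show ?thesis unfolding filterlim_at_top by blast
  qed
  have i_bd: "\<bar>i n t\<bar> \<le> M" for n t
  proof -
    have "norm (i n t) \<le> (LINT s|lborel. M * h s)"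
      unfolding i_def
    proof (rule Bochner_Integration.integral_norm_bound_integral)
      show "integrable lborel (\<lambda>s. M * h s)" using hI by simp
      show bd: "norm (g (x0 + s / real (Suc n), t) * h s) \<le> M * h s" for s
        using M h(2) by (auto simp: abs_mult intro!: mult_mono)
      show "integrable lborel (\<lambda>s. g (x0 + s / real (Suc n), t) * h s)"
        by (rule Bochner_Integration.integrable_bound[OF \<open>integrable lborel (\<lambda>s. M * h s)\<close>])
          (use bd M h(2) in \<open>auto simp: abs_mult intro!: mult_mono\<close>)
    qed
    then show ?thesis using h1 by simp
  qed
  \<comment> \<open>For fixed \<open>s\<close> the sample point converges to \<open>(x0, t)\<close>,
    an interior point of the box where \<open>f\<close> is continuous, and \<open>h\<close> has mass
    1.\<close>
  have i_lim: "(\<lambda>n. i n t) \<longlonglongrightarrow> f (x0, t)" if t: "C < t" "t < D" for t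
  proof -
    have "(\<lambda>n. LINT s|lborel. g (x0 + s / real (Suc n), t) * h s)
        \<longlonglongrightarrow> (LINT s|lborel. f (x0, t) * h s)"
    proof (rule integral_dominated_convergence[where w="\<lambda>s. M * h s"])
      show "integrable lborel (\<lambda>s. M * h s)" using hI by simp
      show "AE s in lborel. norm (g (x0 + s / real (Suc n), t) * h s) \<le> M * h s" for n
        using M h(2) by (auto simp: abs_mult intro!: mult_mono)
      show "AE s in lborel. (\<lambda>n. g (x0 + s / real (Suc n), t) * h s) \<longlonglongrightarrow> f (x0, t) * h s"
      proof (rule AE_I2, rule tendsto_mult_right)
        fix s :: real
        have "(x0, t) \<in> box (A,C) (B,D)" using t x0 by (simp add: mem_box Basis_prod_def)
        then have "isCont f (x0, t)"
          using f continuous_on_interior by (metis interior_cbox)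
        moreover have l: "(\<lambda>n. (x0 + s / real (Suc n), t)) \<longlonglongrightarrow> (x0, t)"
        proof -
          have "(\<lambda>n. s * inverse (real (Suc n))) \<longlonglongrightarrow> s * 0"
            by (intro tendsto_intros LIMSEQ_inverse_real_of_nat)
          then have "(\<lambda>n. x0 + s * inverse (real (Suc n))) \<longlonglongrightarrow> x0 + 0" by (intro tendsto_intros) auto
          then show ?thesis by (intro tendsto_Pair) (auto simp: divide_inverse)
        qed
        ultimately have "(\<lambda>n. f (x0 + s / real (Suc n), t)) \<longlonglongrightarrow> f (x0, t)"
          by (rule isCont_tendsto_compose)
        moreover have "\<forall>\<^sub>F n in sequentially. (x0 + s / real (Suc n), t) \<in> box (A,C) (B,D)"
          using l \<open>(x0, t) \<in> box (A,C) (B,D)\<close> by (intro topological_tendstoD) (auto simp: open_box)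
        then have "\<forall>\<^sub>F n in sequentially. f (x0 + s / real (Suc n), t) = g (x0 + s / real (Suc n), t)"
        proof eventually_elim
          case (elim n)
          then have "(x0 + s / real (Suc n), t) \<in> Q" using box_subset_cbox unfolding Q_def by blast
          then show ?case by (simp add: g_def)
        qed
        ultimately show "(\<lambda>n. g (x0 + s / real (Suc n), t)) \<longlonglongrightarrow> f (x0, t)"
          by (rule Lim_transform_eventually)
      qed
    qed measurable
    then show ?thesis using h1 by (simp add: i_def)
  qed
  have im [measurable]: "i n \<in> borel_measurable borel" for n
    unfolding i_def by measurable
  have I_eq: "(LINT z|lborel. indicator Q z * f z * (real (Suc n) * h (real (Suc n) * (fst z - x0)) *
        (H (real (Suc n) * (snd z - y0)) - H (real (Suc n) * (snd z - y1))))) = (LINT t|lborel. b n t * i n t)" for n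
  proof -
    define k where "k = real (Suc n)"
    have k: "k > 0" by (simp add: k_def)
    have "integrable lborel (\<lambda>z. indicator Q z *\<^sub>R (f z * (k * h (k * (fst z - x0)) * b n (snd z))))"
      unfolding b_def
      by (intro borel_integrable_compact[OF Q] continuous_intros fQ
          continuous_on_compose2[OF h(1)] continuous_on_compose2[OF Hc]) auto
    then have int: "integrable (lborel \<Otimes>\<^sub>M lborel) (\<lambda>(x, t). g (x, t) * (k * h (k * (x - x0)) * b n t))"
      unfolding lborel_prod by (simp add: g_def case_prod_unfold mult.assoc)
    have "(LINT z|lborel. indicator Q z * f z * (k * h (k * (fst z - x0)) * b n (snd z)))
      = (LINT z|(lborel \<Otimes>\<^sub>M lborel). (\<lambda>(x, t). g (x, t) * (k * h (k * (x - x0)) * b n t)) z)"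
      unfolding lborel_prod by (simp add: g_def case_prod_unfold)
    also have "\<dots> = (LINT t|lborel. LINT x|lborel. g (x, t) * (k * h (k * (x - x0)) * b n t))"
      by (rule lborel_pair.integral_snd[OF int, symmetric])
    also have "\<dots> = (LINT t|lborel. b n t * i n t)"
    proof (rule Bochner_Integration.integral_cong[OF refl])
      fix t
      have "(LINT x|lborel. g (x, t) * (k * h (k * (x - x0)) * b n t))
        = \<bar>1/k\<bar> *\<^sub>R (LINT s|lborel. g (x0 + 1/k * s, t) * (k * h (k * (x0 + 1/k * s - x0)) * b n t))"
        by (rule lborel_integral_real_affine) (use k in auto)
      also have "\<dots> = (LINT s|lborel. b n t * (g (x0 + s / k, t) * h s))"
        using k by (subst integral_scaleR_right[symmetric]) (auto simp: mult_ac)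
      also have "\<dots> = b n t * i n t" by (simp add: i_def k_def)
      finally show "(LINT x|lborel. g (x, t) * (k * h (k * (x - x0)) * b n t)) = b n t * i n t" .
    qed
    finally show ?thesis by (simp add: k_def b_def)
  qed
  \<comment> \<open>The limit interval is open at \<open>y0\<close> and closed at \<open>y1\<close>,
    because \<open>H\<close> vanishes at the argument 0. As the scale is at least 1,
    \<open>b n\<close> vanishes beyond \<open>y1 + 1\<close>, which gives an integrable bound
    uniform in \<open>n\<close>.\<close>
  have "(\<lambda>n. LINT t|lborel. b n t * i n t) \<longlonglongrightarrow> (LINT t|lborel. indicator {y0<..y1} t * f (x0, t))"
  proof (rule integral_dominated_convergence[where w="\<lambda>t. indicator {y0..y1+1} t * M"])
    have "integrable lborel (\<lambda>t. indicator {y0..y1+1} t *\<^sub>R M)"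
      by (intro borel_integrable_compact) auto
    then show "integrable lborel (\<lambda>t. indicator {y0..y1+1} t * M)" by simp
    show "AE t in lborel. norm (b n t * i n t) \<le> indicator {y0..y1+1} t * M" for n
    proof (rule AE_I2)
      fix t
      consider "t < y0" | "t > y1 + 1" | "t \<in> {y0..y1+1}" by force
      then show "norm (b n t * i n t) \<le> indicator {y0..y1+1} t * M"
      proof cases
        case 1
        then show ?thesis using b0 by simp
      next
        case 2
        then have "1 * 1 \<le> real (Suc n) * (t - y1)" by (intro mult_mono) auto
        then show ?thesis using b2 M by simp
      next
        case 3
        have "\<bar>b n t\<bar> * \<bar>i n t\<bar> \<le> 1 * M" by (intro mult_mono b_bd i_bd) auto
        then show ?thesis using 3 by (simp add: abs_mult)
      qed
    qed
    show "AE t in lborel. (\<lambda>n. b n t * i n t) \<longlonglongrightarrow> indicator {y0<..y1} t * f (x0, t)"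
    proof (rule AE_I2)
      fix t
      consider "t \<le> y0" | "t > y1" | "y0 < t" "t \<le> y1" by linarith
      then show "(\<lambda>n. b n t * i n t) \<longlonglongrightarrow> indicator {y0<..y1} t * f (x0, t)"
      proof cases
        case 1
        then show ?thesis using b0 by simp
      next
        case 2
        have "\<forall>\<^sub>F n in sequentially. b n t * i n t = 0"
          using large[of "t - y1"] 2 by (auto elim!: eventually_mono simp: b2)
        then show ?thesis using 2 by (simp add: tendsto_eventually)
      next
        case 3
        have "\<forall>\<^sub>F n in sequentially. b n t = 1"
          using large[of "t - y0"] 3
          by (auto elim!: eventually_mono simp: b_def H mult_nonneg_nonpos)
        then have "(\<lambda>n. b n t) \<longlonglongrightarrow> 1" by (rule tendsto_eventually)
        from tendsto_mult[OF this i_lim[of t]] show ?thesis using 3 y by simp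
      qed
    qed
    have "continuous_on {C..D} (\<lambda>t. f (x0, t))"
      by (rule continuous_on_compose2[OF f]) (use x0 in \<open>auto intro!: continuous_intros simp: mem_box Basis_prod_def cbox_def\<close>)
    then have c: "continuous_on {y0<..y1} (\<lambda>t. f (x0, t))"
      by (rule continuous_on_subset) (use y in auto)
    show "(\<lambda>t. indicator {y0<..y1} t * f (x0, t)) \<in> borel_measurable lborel"
      using borel_measurable_continuous_on_indicator[OF _ c] by simp
  qed measurable
  also have "(LINT t|lborel. indicator {y0<..y1} t * f (x0, t)) = integral {y0..y1} (\<lambda>t. f (x0, t))"
  proof -
    have "continuous_on {y0..y1} (\<lambda>t. f (x0, t))"
      by (rule continuous_on_compose2[OF f]) (use x0 y in \<open>auto intro!: continuous_intros simp: mem_box Basis_prod_def cbox_def\<close>)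
    then have int: "set_integrable lborel {y0..y1} (\<lambda>t. f (x0, t))"
      unfolding set_integrable_def by (intro borel_integrable_compact) auto
    have int': "set_integrable lborel {y0<..y1} (\<lambda>t. f (x0, t))"
      by (rule set_integrable_subset[OF int]) auto
    \<comment> \<open>The half-open and the closed interval differ by the null set
      \<open>{y0}\<close>.\<close>
    have "(LINT t|lborel. indicator {y0<..y1} t * f (x0, t)) = (LINT t:{y0..y1}|lborel. f (x0, t))"
      unfolding set_lebesgue_integral_def
    proof (rule integral_cong_AE)
      show "AE t in lborel. indicator {y0<..y1} t * f (x0, t) = indicator {y0..y1} t *\<^sub>R f (x0, t)"
        using AE_lborel_singleton[of y0] by eventually_elim (auto simp: indicator_def)
    qed (use int int' in \<open>auto simp: set_integrable_def\<close>)
    also have "\<dots> = integral {y0..y1} (\<lambda>t. f (x0, t))"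
      by (rule set_borel_integral_eq_integral[OF int])
    finally show ?thesis .
  qed
  finally show ?thesis unfolding I_eq[symmetric] by (simp add: Q_def)
qed

lemma lborel_integral_swap:
  fixes F :: "real \<times> real \<Rightarrow> real"
  assumes "F \<in> borel_measurable borel"
  shows "(LINT z|lborel. F (snd z, fst z)) = (LINT z|lborel. F z)"
proof -
  have "F \<in> borel_measurable (lborel \<Otimes>\<^sub>M lborel)" using assms by (simp add: lborel_prod)
  from lborel_pair.integral_product_swap[OF this]
  show ?thesis by (simp add: lborel_prod case_prod_unfold)
qed

text \<open>The test function is a product of smoothed indicators of [x0,x1] and [y0,y1]. Its
  gradient concentrates on the four sides of the rectangle, and \<open>flux_limit\<close> turns each
  side into one line integral. The conclusion says that the field (f1, f2) has no net flux through
  the boundary of the rectangle.\<close>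

lemma rectangle_flux:
  fixes f1 f2 :: "real \<times> real \<Rightarrow> real"
  assumes f: "continuous_on (cbox (A,C) (B,D)) f1" "continuous_on (cbox (A,C) (B,D)) f2"
    and weak: "\<And>\<alpha> \<beta> \<alpha>' \<beta>'. \<lbrakk>smooth \<alpha>; smooth \<beta>;
      \<And>x. (\<alpha> has_real_derivative \<alpha>' x) (at x); \<And>x. (\<beta> has_real_derivative \<beta>' x) (at x);
      \<And>x. x \<notin> {A..B} \<Longrightarrow> \<alpha> x = 0; \<And>x. x \<notin> {C..D} \<Longrightarrow> \<beta> x = 0\<rbrakk> \<Longrightarrow>
      (LINT z|lborel. indicator (cbox (A,C) (B,D)) z *
        (f1 z * (\<alpha>' (fst z) * \<beta> (snd z)) + f2 z * (\<alpha> (fst z) * \<beta>' (snd z)))) = 0"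
    and x: "A < x0" "x0 \<le> x1" "x1 < B" and y: "C < y0" "y0 \<le> y1" "y1 < D"
  shows "integral {y0..y1} (\<lambda>t. f1 (x0, t)) - integral {y0..y1} (\<lambda>t. f1 (x1, t))
    + integral {x0..x1} (\<lambda>s. f2 (s, y0)) - integral {x0..x1} (\<lambda>s. f2 (s, y1)) = 0"
proof -
  obtain H h :: "real \<Rightarrow> real" where h: "smooth h" and H: "\<And>x. (H has_real_derivative h x) (at x)"
    "\<And>x. x \<le> 0 \<Longrightarrow> H x = 0" "\<And>x. 1 \<le> x \<Longrightarrow> H x = 1"
    and h': "\<And>x. 0 \<le> h x" "\<And>x. x \<le> 0 \<or> 1 \<le> x \<Longrightarrow> h x = 0"
    by (rule smooth_step) blast
  have hc: "continuous_on UNIV h" using h by (rule smooth_continuous)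
  have sH: "smooth H" using H(1) h by (rule smooth_antiderivative)
  have Hc: "continuous_on UNIV H" using sH by (rule smooth_continuous)
  define Q where "Q = cbox (A,C) (B,D)"
  have Q: "compact Q" unfolding Q_def by (rule compact_cbox)
  have fQ: "continuous_on Q f1" "continuous_on Q f2" using f by (simp_all add: Q_def)
  define \<kappa> where "\<kappa> = (\<lambda>n. real (Suc n))"
  define a where "a = (\<lambda>n s. H (\<kappa> n * (s - x0)) - H (\<kappa> n * (s - x1)))"
  define b where "b = (\<lambda>n t. H (\<kappa> n * (t - y0)) - H (\<kappa> n * (t - y1)))"
  define \<eta> where "\<eta> = (\<lambda>n c s. \<kappa> n * h (\<kappa> n * (s - c)))"
  define T1 where "T1 = (\<lambda>n c. LINT z|lborel. indicator Q z * f1 z * (\<eta> n c (fst z) * b n (snd z)))"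
  define T2 where "T2 = (\<lambda>n c. LINT z|lborel. indicator Q z * f2 z * (a n (fst z) * \<eta> n c (snd z)))"
  have \<kappa>: "\<kappa> n \<ge> 1" for n by (simp add: \<kappa>_def)
  have large: "\<forall>\<^sub>F n in sequentially. 1 \<le> \<kappa> n * d" if "d > 0" for d
  proof -
    have "filterlim (\<lambda>n. real (Suc n) * d) at_top sequentially"
      by (rule filterlim_at_top_mult_tendsto_pos[OF tendsto_const that])
        (rule filterlim_compose[OF filterlim_real_sequentially filterlim_Suc])
    then show ?thesis unfolding filterlim_at_top \<kappa>_def by blast
  qed
  have [continuous_intros]: "continuous_on S (\<lambda>z. \<eta> n c (p z))" "continuous_on S (\<lambda>z. a n (p z))"
    "continuous_on S (\<lambda>z. b n (p z))" if "continuous_on S p" for S n c and p :: "real \<times> real \<Rightarrow> real"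
    unfolding \<eta>_def a_def b_def using that
    by (auto intro!: continuous_intros continuous_on_compose2[OF hc] continuous_on_compose2[OF Hc])
  have T1: "(\<lambda>n. T1 n c) \<longlonglongrightarrow> integral {y0..y1} (\<lambda>t. f1 (c, t))" if "A < c" "c < B" for c
    using flux_limit[OF f(1) that y hc h' H] by (simp add: T1_def Q_def \<eta>_def b_def \<kappa>_def)
  have T2: "(\<lambda>n. T2 n c) \<longlonglongrightarrow> integral {x0..x1} (\<lambda>s. f2 (s, c))" if "C < c" "c < D" for c
  proof -
    \<comment> \<open>Horizontal sides are reduced to vertical ones by exchanging the
      coordinates.\<close>
    have "continuous_on (cbox (C,A) (D,B)) (\<lambda>z. f2 (snd z, fst z))"
      by (rule continuous_on_compose2[OF f(2)])
        (auto intro!: continuous_intros simp: cbox_def Basis_prod_def)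
    from flux_limit[OF this that x hc h' H]
    have "(\<lambda>n. LINT z|lborel. indicator (cbox (C,A) (D,B)) z * f2 (snd z, fst z) *
      (\<eta> n c (fst z) * a n (snd z))) \<longlonglongrightarrow> integral {x0..x1} (\<lambda>s. f2 (s, c))"
      by (simp add: \<eta>_def a_def \<kappa>_def)
    moreover have "(LINT z|lborel. indicator (cbox (C,A) (D,B)) z * f2 (snd z, fst z) *
      (\<eta> n c (fst z) * a n (snd z))) = T2 n c" for n
    proof -
      define F where "F = (\<lambda>z. indicator Q z * f2 z * (a n (fst z) * \<eta> n c (snd z)))"
      have "integrable lborel (\<lambda>z. indicator Q z *\<^sub>R (f2 z * (a n (fst z) * \<eta> n c (snd z))))"
        by (intro borel_integrable_compact[OF Q] continuous_intros fQ)
      then have "F \<in> borel_measurable borel" by (auto simp: F_def mult.assoc)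
      moreover have "indicator Q (snd z, fst z) = (indicator (cbox (C,A) (D,B)) z :: real)" for z
        by (cases z) (auto simp: Q_def cbox_Pair_eq indicator_def)
      ultimately show ?thesis
        using lborel_integral_swap[of F] by (simp add: F_def T2_def mult_ac)
    qed
    ultimately show ?thesis by simp
  qed
  have lim: "(\<lambda>n. T1 n x0 - T1 n x1 + T2 n y0 - T2 n y1) \<longlonglongrightarrow>
     integral {y0..y1} (\<lambda>t. f1 (x0, t)) - integral {y0..y1} (\<lambda>t. f1 (x1, t))
    + integral {x0..x1} (\<lambda>s. f2 (s, y0)) - integral {x0..x1} (\<lambda>s. f2 (s, y1))"
    by (intro tendsto_intros T1 T2) (use x y in auto)
  have xB: "B - x1 > 0" and yD: "D - y1 > 0" using x y by auto
  \<comment> \<open>Once the scale is so large that the upper steps are completed before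
    \<open>B\<close> and \<open>D\<close>, the factors vanish outside the box and the weak equation
    applies to them exactly.\<close>
  have "\<forall>\<^sub>F n in sequentially. T1 n x0 - T1 n x1 + T2 n y0 - T2 n y1 = 0"
    using large[OF xB] large[OF yD]
  proof eventually_elim
    case (elim n)
    have sm: "smooth (\<lambda>s. H (\<kappa> n * (s - c)))" for c
      using smooth_affine[OF sH, of "\<kappa> n" "- \<kappa> n * c"] by (simp add: algebra_simps)
    have sm: "smooth (\<lambda>s. H (\<kappa> n * (s - c)) - H (\<kappa> n * (s - d)))" for c d
      using smooth_add[OF sm[of c] smooth_mult[OF smooth_const[of "-1"] sm[of d]]] by simp
    have Hd: "((\<lambda>s. H (\<kappa> n * (s - c))) has_real_derivative \<eta> n c s) (at s)" for c s
      by (rule DERIV_chain2[THEN DERIV_cong, OF H(1)]) (auto intro!: derivative_eq_intros simp: \<eta>_def)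
    have 0: "H (\<kappa> n * (s - c)) = 0" if "s \<le> c" for s c
      using that \<kappa>[of n] by (intro H(2)) (simp add: mult_nonneg_nonpos)
    have 1: "H (\<kappa> n * (s - c)) = 1" if "1 \<le> \<kappa> n * (d - c)" "d \<le> s" for s c d
    proof (rule H(3))
      have "\<kappa> n * (d - c) \<le> \<kappa> n * (s - c)" using that \<kappa>[of n] by (intro mult_left_mono) auto
      then show "1 \<le> \<kappa> n * (s - c)" using that by simp
    qed
    have one': "H (\<kappa> n * (s - c)) = 1" if "1 \<le> \<kappa> n * (d - c')" "d \<le> s" "c \<le> c'" for s c c' d
    proof (rule 1[OF _ that(2)])
      have "\<kappa> n * (d - c') \<le> \<kappa> n * (d - c)" using that \<kappa>[of n] by (intro mult_left_mono) auto
      then show "1 \<le> \<kappa> n * (d - c)" using that by simp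
    qed
    have "(LINT z|lborel. indicator Q z *
        (f1 z * ((\<eta> n x0 (fst z) - \<eta> n x1 (fst z)) * b n (snd z))
        + f2 z * (a n (fst z) * (\<eta> n y0 (snd z) - \<eta> n y1 (snd z))))) = 0"
      unfolding Q_def
    proof (rule weak)
      show "smooth (a n)" "smooth (b n)" unfolding a_def b_def by (rule sm)+
      show "(a n has_real_derivative \<eta> n x0 s - \<eta> n x1 s) (at s)"
        "(b n has_real_derivative \<eta> n y0 s - \<eta> n y1 s) (at s)" for s
        unfolding a_def b_def by (intro DERIV_diff Hd)+
      show "a n s = 0" if "s \<notin> {A..B}" for s
        using that x 0[of s x0] 0[of s x1] 1[of B x1 s] one'[of B x1 s x0] elim(1)
        by (force simp: a_def)
      show "b n s = 0" if "s \<notin> {C..D}" for s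
        using that y 0[of s y0] 0[of s y1] 1[of D y1 s] one'[of D y1 s y0] elim(2)
        by (force simp: b_def)
    qed
    moreover have "(LINT z|lborel. indicator Q z *
        (f1 z * ((\<eta> n x0 (fst z) - \<eta> n x1 (fst z)) * b n (snd z))
        + f2 z * (a n (fst z) * (\<eta> n y0 (snd z) - \<eta> n y1 (snd z)))))
      = T1 n x0 - T1 n x1 + (T2 n y0 - T2 n y1)"
    proof -
      have i1: "integrable lborel (\<lambda>z. indicator Q z * f1 z * (\<eta> n c (fst z) * b n (snd z)))" for c
      proof -
        have "continuous_on Q (\<lambda>z. f1 z * (\<eta> n c (fst z) * b n (snd z)))"
          by (intro continuous_intros fQ)
        from borel_integrable_compact[OF Q this] show ?thesis by (simp add: mult.assoc)
      qed
      have i2: "integrable lborel (\<lambda>z. indicator Q z * f2 z * (a n (fst z) * \<eta> n c (snd z)))" for c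
      proof -
        have "continuous_on Q (\<lambda>z. f2 z * (a n (fst z) * \<eta> n c (snd z)))"
          by (intro continuous_intros fQ)
        from borel_integrable_compact[OF Q this] show ?thesis by (simp add: mult.assoc)
      qed
      show ?thesis unfolding T1_def T2_def
        by (subst Bochner_Integration.integral_diff[symmetric], (intro i1 i2)+)+
          (subst Bochner_Integration.integral_add[symmetric],
            (intro i1 i2 Bochner_Integration.integrable_diff)+, simp add: algebra_simps)
    qed
    ultimately show ?case by simp
  qed
  then have "(\<lambda>n. T1 n x0 - T1 n x1 + T2 n y0 - T2 n y1) \<longlonglongrightarrow> 0"
    by (rule tendsto_eventually)
  with lim show ?thesis by (rule LIMSEQ_unique)
qed

section \<open>Potentials of fields without flux through rectangles\<close>

lemma potential_of_flux_free:
  fixes f1 f2 :: "real \<times> real \<Rightarrow> real"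
  assumes f: "continuous_on (cbox (A,C) (B,D)) f1" "continuous_on (cbox (A,C) (B,D)) f2"
    and flux: "\<And>x1 y1. \<lbrakk>A \<le> x1; x1 \<le> B; C \<le> y1; y1 \<le> D\<rbrakk> \<Longrightarrow>
      integral {C..y1} (\<lambda>t. f1 (A, t)) - integral {C..y1} (\<lambda>t. f1 (x1, t))
    + integral {A..x1} (\<lambda>s. f2 (s, C)) - integral {A..x1} (\<lambda>s. f2 (s, y1)) = 0"
  obtains \<psi> :: "real \<times> real \<Rightarrow> real" where
    "\<And>z. z \<in> box (A,C) (B,D) \<Longrightarrow> (\<psi> has_derivative (\<lambda>w. f2 z * fst w - f1 z * snd w)) (at z)"
proof -
  \<comment> \<open>The integral of (f2, -f1), the field rotated by a negative right angle, along
    the bottom side and then up the vertical line through \<open>x\<close>.\<close>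
  define \<psi> where "\<psi> = (\<lambda>x y. integral {A..x} (\<lambda>s. f2 (s, C)) - integral {C..y} (\<lambda>t. f1 (x, t)))"
  \<comment> \<open>Vanishing flux lets the same value be computed up the left side and then along
    the horizontal line through \<open>y\<close>. The first formula shows the derivative in
    \<open>y\<close>, this one the derivative in \<open>x\<close>.\<close>
  have \<psi>': "\<psi> x y = integral {A..x} (\<lambda>s. f2 (s, y)) - integral {C..y} (\<lambda>t. f1 (A, t))"
    if "A \<le> x" "x \<le> B" "C \<le> y" "y \<le> D" for x y
    using flux[OF that] unfolding \<psi>_def by linarith
  show thesis
  proof (rule that[of "\<lambda>(x, y). \<psi> x y"])
    fix z assume z: "z \<in> box (A,C) (B,D)"
    define x y where "x = fst z" and "y = snd z"
    have xy: "A < x" "x < B" "C < y" "y < D" "z = (x, y)"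
      using z by (cases z; auto simp: x_def y_def box_def Basis_prod_def)+
    have 1: "((\<lambda>x. \<psi> x y) has_derivative (\<lambda>w. f2 (x, y) * w)) (at x within {A<..<B})"
    proof -
      have "continuous_on {A..B} (\<lambda>s. f2 (s, y))"
        by (rule continuous_on_compose2[OF f(2)])
          (use xy in \<open>auto intro!: continuous_intros simp: cbox_def Basis_prod_def\<close>)
      from integral_has_real_derivative[OF this, of x] xy
      have "((\<lambda>x. integral {A..x} (\<lambda>s. f2 (s, y)) - integral {C..y} (\<lambda>t. f1 (A, t)))
          has_real_derivative f2 (x, y) - 0) (at x within {A..B})"
        by (intro derivative_intros) auto
      then have "((\<lambda>x. integral {A..x} (\<lambda>s. f2 (s, y)) - integral {C..y} (\<lambda>t. f1 (A, t)))
          has_real_derivative f2 (x, y)) (at x within {A<..<B})"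
        by (rule DERIV_subset[OF DERIV_cong]) auto
      then have "((\<lambda>x. \<psi> x y) has_real_derivative f2 (x, y)) (at x within {A<..<B})"
        by (rule has_field_derivative_transform_within[OF _ zero_less_one]) (use xy \<psi>' in auto)
      then show ?thesis by (simp add: has_field_derivative_def)
    qed
    have 2: "((\<lambda>y. \<psi> x y) has_derivative blinfun_apply (blinfun_scaleR_left (- f1 (x, y)))) (at y within {C<..<D})"
      if xy: "x \<in> {A<..<B}" "y \<in> {C<..<D}" for x y
    proof -
      have "continuous_on {C..D} (\<lambda>t. f1 (x, t))"
        by (rule continuous_on_compose2[OF f(1)])
          (use xy in \<open>auto intro!: continuous_intros simp: cbox_def Basis_prod_def\<close>)
      from integral_has_real_derivative[OF this, of y] xy
      have "((\<lambda>y. \<psi> x y) has_real_derivative 0 - f1 (x, y)) (at y within {C..D})"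
        unfolding \<psi>_def by (intro derivative_intros) auto
      then have "((\<lambda>y. \<psi> x y) has_real_derivative - f1 (x, y)) (at y within {C<..<D})"
        by (rule DERIV_subset[OF DERIV_cong]) auto
      moreover have "(*) (- f1 (x, y)) = blinfun_apply (blinfun_scaleR_left (- f1 (x, y)))"
        by (auto simp: fun_eq_iff)
      ultimately show ?thesis by (simp only: has_field_derivative_def)
    qed
    \<comment> \<open>Joint differentiability follows from both partial derivatives, since the one
      in \<open>y\<close> depends continuously on the point.\<close>
    have 3: "((\<lambda>(x, y). \<psi> x y) has_derivative (\<lambda>(tx, ty). f2 (x, y) * tx + blinfun_apply (blinfun_scaleR_left (- f1 (x, y))) ty))
        (at (x, y) within {A<..<B} \<times> {C<..<D})"
    proof (rule has_derivative_partialsI[OF 1 2])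
      have "isCont f1 (x, y)"
        using continuous_on_interior[OF f(1)] z xy(5) by (metis interior_cbox)
      then have "isCont (\<lambda>z. blinfun_scaleR_left (- f1 z) :: real \<Rightarrow>\<^sub>L real) (x, y)"
        by (intro continuous_intros)
      then show "continuous (at (x, y) within {A<..<B} \<times> {C<..<D})
          (\<lambda>(x, y). blinfun_scaleR_left (- f1 (x, y)) :: real \<Rightarrow>\<^sub>L real)"
        unfolding case_prod_unfold by (simp add: continuous_at_imp_continuous_at_within)
    qed (use xy in auto)
    have "open ({A<..<B} \<times> {C<..<D})" by (intro open_Times) auto
    with 3 xy have "((\<lambda>(x, y). \<psi> x y) has_derivative (\<lambda>(tx, ty). f2 (x, y) * tx + blinfun_apply (blinfun_scaleR_left (- f1 (x, y))) ty)) (at (x, y))"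
      by (subst (asm) at_within_open) auto
    then show "((\<lambda>(x, y). \<psi> x y) has_derivative (\<lambda>w. f2 z * fst w - f1 z * snd w)) (at z)"
      using xy(5) by (simp add: case_prod_unfold mult.commute)
  qed
qed

section \<open>Divergence free unit fields in the plane\<close>

lemma vec2_eq: "vector [x$1, x$2] = (x :: real^2)"
  by (simp add: vec_eq_iff forall_2)

lemma inner_vec2: "x \<bullet> y = x$1 * y$1 + x$2 * (y$2 :: real)" for x y :: "real^2"
  by (simp add: inner_vec_def sum_2)

lemma norm_vec2_le: "norm x \<le> \<bar>x$1\<bar> + \<bar>x$2\<bar>" for x :: "real^2"
  using norm_le_l1_cart[of x] by (simp add: sum_2)

lemma continuous_on_vector2 [continuous_intros]:
  assumes "continuous_on S f" "continuous_on S g"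
  shows "continuous_on S (\<lambda>z. vector [f z, g z] :: real^2)"
proof -
  have eq: "(\<lambda>z. vector [f z, g z] :: real^2) = (\<lambda>z. f z *\<^sub>R axis 1 1 + g z *\<^sub>R axis 2 1)"
    by (auto simp: fun_eq_iff vec_eq_iff forall_2 axis_def)
  show ?thesis unfolding eq using assms by (intro continuous_intros)
qed

text \<open>The weak equation lives on \<open>real^2\<close>, the Fubini arguments on pairs. The two
  Lebesgue measures correspond because they give boxes the same volume.\<close>

lemma lborel_vec2:
  "(lborel :: (real^2) measure) = distr lborel borel (\<lambda>z :: real \<times> real. vector [fst z, snd z])"
proof (rule lborel_eqI)
  let ?v = "\<lambda>z :: real \<times> real. vector [fst z, snd z] :: real^2"
  have m: "?v \<in> borel_measurable borel"
    by (intro borel_measurable_continuous_onI continuous_intros)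
  fix l u :: "real^2"
  assume le: "\<And>b. b \<in> Basis \<Longrightarrow> l \<bullet> b \<le> u \<bullet> b"
  have le: "l$1 \<le> u$1" "l$2 \<le> u$2"
    using le[of "axis 1 1"] le[of "axis 2 1"] by (simp_all add: axis_in_Basis_iff inner_axis)
  have "?v -` box l u = box (l$1, l$2) (u$1, u$2)"
    by (auto simp: box_def Basis_prod_def Basis_vec_def inner_axis forall_2)
  then have "emeasure (distr lborel borel ?v) (box l u) = emeasure lborel (box (l$1, l$2) (u$1, u$2))"
    using m by (subst emeasure_distr) auto
  also have "\<dots> = (\<Prod>b\<in>Basis. ((u$1, u$2) - (l$1, l$2)) \<bullet> b)"
    using le by (subst emeasure_lborel_box) (auto simp: Basis_prod_def)
  also have "(\<Prod>b\<in>Basis. ((u$1, u$2) - (l$1, l$2)) \<bullet> b) = (u$1 - l$1) * (u$2 - l$2)"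
    by (simp add: Basis_prod_def)
  also have "\<dots> = (\<Prod>b\<in>Basis. (u - l) \<bullet> b)"
  proof -
    have "(Basis :: (real^2) set) = {axis 1 1, axis 2 1}"
      by (auto simp: Basis_vec_def UNIV_2)
    then have B: "prod F (Basis :: (real^2) set) = prod F {axis 1 1, axis 2 1}" for F :: "real^2 \<Rightarrow> real"
      by (rule arg_cong)
    show ?thesis unfolding B by (simp add: inner_axis axis_eq_axis)
  qed
  finally show "emeasure (distr lborel borel ?v) (box l u) = (\<Prod>b\<in>Basis. (u - l) \<bullet> b)" .
qed simp

lemma lborel_integral_vec2:
  fixes F :: "real^2 \<Rightarrow> real"
  assumes "F \<in> borel_measurable borel"
  shows "(LINT x|lborel. F x) = (LINT z|lborel. F (vector [fst z, snd z]))"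
proof -
  have m: "(\<lambda>z :: real \<times> real. vector [fst z, snd z] :: real^2) \<in> borel_measurable borel"
    by (intro borel_measurable_continuous_onI continuous_intros)
  show ?thesis by (subst lborel_vec2, subst integral_distr) (use m assms in auto)
qed

section \<open>Product test functions and the local potential of a divergence free field\<close>

lemma grad_eq:
  assumes "(f has_derivative f') (at x)"
  shows "grad f x = (\<chi> i. f' (axis i 1))"
  unfolding grad_def using frechet_derivative_at[OF assms] by simp

lemma product_has_derivative:
  fixes \<alpha> \<beta> :: "real \<Rightarrow> real" and x :: "real^2"
  assumes "(\<alpha> has_real_derivative a) (at (x$1))" "(\<beta> has_real_derivative b) (at (x$2))"
  shows "((\<lambda>x. \<alpha> (x$1) * \<beta> (x$2)) has_derivative
      (\<lambda>w. vector [a * \<beta> (x$2), \<alpha> (x$1) * b] \<bullet> w)) (at x)"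
proof -
  have 1: "((\<lambda>x. x $ i) has_derivative (\<lambda>w. w $ i)) (at x)" for i and x :: "real^2"
    by (rule bounded_linear.has_derivative[OF bounded_linear_vec_nth has_derivative_ident])
  have "((\<lambda>x. \<alpha> (x$1)) has_derivative (\<lambda>w. a * w$1)) (at x)"
    using has_derivative_compose[OF 1 assms(1)[unfolded has_field_derivative_def]] .
  moreover have "((\<lambda>x. \<beta> (x$2)) has_derivative (\<lambda>w. b * w$2)) (at x)"
    using has_derivative_compose[OF 1 assms(2)[unfolded has_field_derivative_def]] .
  ultimately have "((\<lambda>x. \<alpha> (x$1) * \<beta> (x$2)) has_derivative
     (\<lambda>w. \<alpha> (x$1) * (b * w$2) + a * w$1 * \<beta> (x$2))) (at x)"
    by (rule has_derivative_mult)
  then show ?thesis by (simp add: inner_vec2 algebra_simps)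
qed

lemma grad_product:
  fixes \<alpha> \<beta> :: "real \<Rightarrow> real" and x :: "real^2"
  assumes "(\<alpha> has_real_derivative a) (at (x$1))" "(\<beta> has_real_derivative b) (at (x$2))"
  shows "grad (\<lambda>x. \<alpha> (x$1) * \<beta> (x$2)) x = vector [a * \<beta> (x$2), \<alpha> (x$1) * b]"
  by (subst grad_eq[OF product_has_derivative[OF assms]]) (simp add: vec_eq_iff inner_axis forall_2)

text \<open>Each partial derivative of a product \<alpha>(x) \<beta>(y) is again such a product with
  one factor differentiated, so the induction stays within this class.\<close>

lemma Ck_product: "kdiff k \<alpha> \<Longrightarrow> kdiff k \<beta> \<Longrightarrow> Ck k (\<lambda>x. \<alpha> (x$1) * \<beta> (x$2))"
proof (induction k arbitrary: \<alpha> \<beta>)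
  case 0
  then show ?case
    by (auto intro!: continuous_intros continuous_on_compose2[of UNIV \<alpha>] continuous_on_compose2[of UNIV \<beta>])
next
  case (Suc k)
  then obtain \<alpha>' \<beta>' where d: "\<And>x. (\<alpha> has_real_derivative \<alpha>' x) (at x)" "kdiff k \<alpha>'"
    "\<And>x. (\<beta> has_real_derivative \<beta>' x) (at x)" "kdiff k \<beta>'" by auto
  have k: "kdiff k \<alpha>" "kdiff k \<beta>" using Suc.prems kdiff_Suc_imp by blast+
  have "(\<lambda>x. \<alpha> (x$1) * \<beta> (x$2)) differentiable (at x)" for x :: "real^2"
    using product_has_derivative[OF d(1) d(3)] unfolding differentiable_def by blast
  moreover have "Ck k (\<lambda>x. grad (\<lambda>x. \<alpha> (x$1) * \<beta> (x$2)) x $ i)" for i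
  proof -
    have "i = 1 \<or> i = 2" by (rule exhaust_2)
    then show ?thesis
      by (auto simp: grad_product[OF d(1) d(3)] intro!: Suc.IH d k)
  qed
  ultimately show ?case by simp
qed

text \<open>Testing with products of one-variable functions makes the flux through small rectangles
  vanish. The potential then has gradient \<open>- vecF (N x)\<close>, the field turned by a
  negative right angle.\<close>

lemma local_potential:
  fixes N :: "real^2 \<Rightarrow> real^2"
  assumes U: "open U" and N: "continuous_on U N"
    and weak: "\<And>\<phi>. test_function U \<phi> \<Longrightarrow> (LINT x|lborel. indicator U x * (N x \<bullet> grad \<phi> x)) = 0"
    and p: "p \<in> U"
  obtains r \<psi> where "r > 0" "ball p r \<subseteq> U"
    "\<And>x. x \<in> ball p r \<Longrightarrow> (\<psi> has_derivative (\<lambda>w. - vecF (N x) \<bullet> w)) (at x)"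
proof -
  obtain r0 where r0: "r0 > 0" "cball p r0 \<subseteq> U" using U p open_contains_cball by blast
  \<comment> \<open>The outer box has half side 2d. The sum of the two coordinate differences is
    then at most 4d = \<open>r0\<close>, which keeps the box inside the closed ball.\<close>
  define d where "d = r0 / 4"
  have d: "d > 0" using r0 by (simp add: d_def)
  define A B C D where "A = p$1 - 2*d" "B = p$1 + 2*d" "C = p$2 - 2*d" "D = p$2 + 2*d"
  note ABCD = A_B_C_D_def
  have inU: "x \<in> U" if "A \<le> x$1" "x$1 \<le> B" "C \<le> x$2" "x$2 \<le> D" for x
  proof -
    have "norm (x - p) \<le> \<bar>(x - p)$1\<bar> + \<bar>(x - p)$2\<bar>" by (rule norm_vec2_le)
    also have "\<dots> \<le> r0" using that unfolding ABCD d_def by (simp add: abs_if)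
    finally show ?thesis using r0 by (auto simp: dist_norm norm_minus_commute)
  qed
  define v :: "real \<times> real \<Rightarrow> real^2" where "v = (\<lambda>z. vector [fst z, snd z])"
  have v: "v z $ 1 = fst z" "v z $ 2 = snd z" for z by (auto simp: v_def)
  define Q where "Q = cbox (A,C) (B,D)"
  have Q: "z \<in> Q \<longleftrightarrow> A \<le> fst z \<and> fst z \<le> B \<and> C \<le> snd z \<and> snd z \<le> D" for z
    by (cases z) (auto simp: Q_def cbox_Pair_eq)
  define f1 f2 where "f1 = (\<lambda>z. N (v z) $ 1)" and "f2 = (\<lambda>z. N (v z) $ 2)"
  have "continuous_on Q (\<lambda>z. N (v z))"
    by (rule continuous_on_compose2[OF N])
      (auto simp: v_def Q intro!: inU continuous_intros)
  then have f: "continuous_on Q f1" "continuous_on Q f2"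
    unfolding f1_def f2_def by (auto intro!: continuous_intros)
  have flux: "integral {y0..y1} (\<lambda>t. f1 (x0, t)) - integral {y0..y1} (\<lambda>t. f1 (x1, t))
    + integral {x0..x1} (\<lambda>s. f2 (s, y0)) - integral {x0..x1} (\<lambda>s. f2 (s, y1)) = 0"
    if xy: "A < x0" "x0 \<le> x1" "x1 < B" "C < y0" "y0 \<le> y1" "y1 < D" for x0 x1 y0 y1
  proof (rule rectangle_flux[OF f[unfolded Q_def] _ xy])
    fix \<alpha> \<beta> \<alpha>' \<beta>' :: "real \<Rightarrow> real"
    assume s: "smooth \<alpha>" "smooth \<beta>" and d: "\<And>x. (\<alpha> has_real_derivative \<alpha>' x) (at x)"
      "\<And>x. (\<beta> has_real_derivative \<beta>' x) (at x)"
      and 0: "\<And>x. x \<notin> {A..B} \<Longrightarrow> \<alpha> x = 0" "\<And>x. x \<notin> {C..D} \<Longrightarrow> \<beta> x = 0"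
    \<comment> \<open>The complement of a closed interval is open, so a function vanishing there has
      zero derivative there as well.\<close>
    have der0: "g' x = 0" if "\<And>x. (g has_real_derivative g' x) (at x)" "\<And>x. x \<notin> {a..b} \<Longrightarrow> g x = 0"
      "x \<notin> {a..b}" for g g' :: "real \<Rightarrow> real" and a b x
    proof -
      have "(g has_real_derivative 0) (at x)"
        by (rule has_field_derivative_transform_within_open[OF DERIV_const[of 0], of "- {a..b}"])
          (use that in auto)
      with that(1) show ?thesis by (rule DERIV_unique)
    qed
    define \<phi> where "\<phi> = (\<lambda>x :: real^2. \<alpha> (x$1) * \<beta> (x$2))"
    have g: "grad \<phi> x = vector [\<alpha>' (x$1) * \<beta> (x$2), \<alpha> (x$1) * \<beta>' (x$2)]" for x
      unfolding \<phi>_def by (rule grad_product[OF d])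
    have supp: "closure {x. \<phi> x \<noteq> 0} \<subseteq> cbox (vector [A, C]) (vector [B, D])"
    proof (rule closure_minimal[OF _ closed_cbox])
      show "{x. \<phi> x \<noteq> 0} \<subseteq> cbox (vector [A, C]) (vector [B, D])"
        using 0 by (auto simp: \<phi>_def mem_box_cart forall_2; force)
    qed
    have "test_function U \<phi>"
      unfolding test_function_def
    proof (intro conjI allI)
      show "Ck k \<phi>" for k unfolding \<phi>_def using s by (auto intro!: Ck_product simp: smooth_def)
      show "compact (closure {x. \<phi> x \<noteq> 0})"
        using supp bounded_cbox bounded_subset by (metis compact_eq_bounded_closed closed_closure)
      show "closure {x. \<phi> x \<noteq> 0} \<subseteq> U"
        using supp inU by (fastforce simp: mem_box_cart forall_2)
    qed
    from weak[OF this] have "0 = (LINT x|lborel. indicator U x * (N x \<bullet> grad \<phi> x))" by simp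
    also have "\<dots> = (LINT z|lborel. indicator U (v z) * (N (v z) \<bullet> grad \<phi> (v z)))"
      unfolding v_def
    proof (rule lborel_integral_vec2)
      have c: "continuous_on UNIV \<alpha>'" "continuous_on UNIV \<beta>'" "continuous_on UNIV \<alpha>" "continuous_on UNIV \<beta>"
        using s smooth_derivative[OF d(1) s(1)] smooth_derivative[OF d(2) s(2)] smooth_continuous by auto
      have "continuous_on U (\<lambda>x. N x \<bullet> grad \<phi> x)"
        unfolding g by (intro continuous_intros N continuous_on_compose2[OF c(1)] continuous_on_compose2[OF c(2)]
            continuous_on_compose2[OF c(3)] continuous_on_compose2[OF c(4)]) auto
      from borel_measurable_continuous_on_indicator[OF _ this]
      show "(\<lambda>x. indicator U x * (N x \<bullet> grad \<phi> x)) \<in> borel_measurable borel" using U by simp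
    qed
    also have "\<dots> = (LINT z|lborel. indicator (cbox (A,C) (B,D)) z *
        (f1 z * (\<alpha>' (fst z) * \<beta> (snd z)) + f2 z * (\<alpha> (fst z) * \<beta>' (snd z))))"
    proof (rule Bochner_Integration.integral_cong[OF refl])
      fix z
      have e: "N (v z) \<bullet> grad \<phi> (v z) = f1 z * (\<alpha>' (fst z) * \<beta> (snd z)) + f2 z * (\<alpha> (fst z) * \<beta>' (snd z))"
        by (simp add: g inner_vec2 v f1_def f2_def)
      show "indicator U (v z) * (N (v z) \<bullet> grad \<phi> (v z)) = indicator (cbox (A,C) (B,D)) z *
        (f1 z * (\<alpha>' (fst z) * \<beta> (snd z)) + f2 z * (\<alpha> (fst z) * \<beta>' (snd z)))"
      proof (cases "z \<in> Q")
        case True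
        then have "v z \<in> U" by (intro inU) (auto simp: Q v)
        then show ?thesis using True e by (simp add: Q_def)
      next
        case False
        then have "fst z \<notin> {A..B} \<or> snd z \<notin> {C..D}" by (auto simp: Q)
        then have "N (v z) \<bullet> grad \<phi> (v z) = 0"
          unfolding e using 0 der0[OF d(1) 0(1)] der0[OF d(2) 0(2)] by auto
        then show ?thesis using False by (simp add: Q_def)
      qed
    qed
    finally show "(LINT z|lborel. indicator (cbox (A,C) (B,D)) z *
        (f1 z * (\<alpha>' (fst z) * \<beta> (snd z)) + f2 z * (\<alpha> (fst z) * \<beta>' (snd z)))) = 0" by simp
  qed
  \<comment> \<open>Fluxes are controlled only for rectangles strictly inside the outer box; hence a
    box of half side d is used for the potential.\<close>
  define a b c e where "a = p$1 - d" "b = p$1 + d" "c = p$2 - d" "e = p$2 + d"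
  note abce = a_b_c_e_def
  have sub: "cbox (a,c) (b,e) \<subseteq> Q" using d by (auto simp: Q_def cbox_Pair_eq abce ABCD)
  obtain \<Psi> where \<Psi>: "\<And>z. z \<in> box (a,c) (b,e) \<Longrightarrow>
      (\<Psi> has_derivative (\<lambda>w. f2 z * fst w - f1 z * snd w)) (at z)"
  proof (rule potential_of_flux_free)
    show "continuous_on (cbox (a,c) (b,e)) f1" "continuous_on (cbox (a,c) (b,e)) f2"
      using f sub continuous_on_subset by blast+
    show "integral {c..y1} (\<lambda>t. f1 (a, t)) - integral {c..y1} (\<lambda>t. f1 (x1, t))
      + integral {a..x1} (\<lambda>s. f2 (s, c)) - integral {a..x1} (\<lambda>s. f2 (s, y1)) = 0"
      if "a \<le> x1" "x1 \<le> b" "c \<le> y1" "y1 \<le> e" for x1 y1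
      by (rule flux) (use that d in \<open>auto simp: abce ABCD\<close>)
  qed blast
  show thesis
  proof (rule that[of d "\<lambda>x. \<Psi> (x$1, x$2)"])
    show "ball p d \<subseteq> U" using r0 d by (auto simp: d_def)
    fix x assume x: "x \<in> ball p d"
    have "\<bar>(x - p)$1\<bar> < d" "\<bar>(x - p)$2\<bar> < d"
      using x component_le_norm_cart[of "x - p"] by (auto simp: dist_norm norm_minus_commute intro: le_less_trans)
    then have "(x$1, x$2) \<in> box (a,c) (b,e)"
      by (auto simp: box_def Basis_prod_def abce abs_less_iff)
    note 1 = \<Psi>[OF this]
    have "((\<lambda>x. x $ i) has_derivative (\<lambda>w. w $ i)) (at x)" for i
      by (rule bounded_linear.has_derivative[OF bounded_linear_vec_nth has_derivative_ident])
    then have "((\<lambda>x. (x$1, x$2)) has_derivative (\<lambda>w. (w$1, w$2))) (at x)"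
      by (intro has_derivative_Pair)
    from has_derivative_compose[OF this 1]
    show "((\<lambda>x. \<Psi> (x$1, x$2)) has_derivative (\<lambda>w. - vecF (N x) \<bullet> w)) (at x)"
      by (simp add: inner_vec2 vecF_def f1_def f2_def v_def vec2_eq)
  qed (use d in auto)
qed

text \<open>A function with gradient of length 1 rises by at least \<rho> from the centre to its
  maximum over the sphere of radius \<rho>. Along the radius to a maximum point it can rise at most
  at rate 1, so the rate is 1 throughout and the gradient points along this radius, also at the
  centre.\<close>

lemma eikonal_line_forward:
  fixes \<psi> :: "'a::euclidean_space \<Rightarrow> real" and e :: "'a \<Rightarrow> 'a"
  assumes der: "\<And>x. x \<in> ball p r \<Longrightarrow> (\<psi> has_derivative (\<lambda>w. e x \<bullet> w)) (at x)"
    and e: "\<And>x. x \<in> ball p r \<Longrightarrow> norm (e x) = 1"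
    and \<rho>: "0 < \<rho>" "\<rho> < r" and t: "0 \<le> t" "t < \<rho>"
  shows "e (p + t *\<^sub>R e p) = e p"
proof -
  have dir: "((\<lambda>t. \<psi> (x + t *\<^sub>R w)) has_real_derivative e (x + t *\<^sub>R w) \<bullet> w) (at t)"
    if "x + t *\<^sub>R w \<in> ball p r" for x w t
  proof -
    have "((\<lambda>t. x + t *\<^sub>R w) has_derivative (\<lambda>s. s *\<^sub>R w)) (at t)"
      by (auto intro!: derivative_eq_intros)
    from has_derivative_compose[OF this der[OF that]]
    show ?thesis by (simp add: has_field_derivative_def mult.commute[of _ "e (x + t *\<^sub>R w) \<bullet> w"])
  qed
  have cont: "continuous_on (cball p \<rho>) \<psi>"
    using \<rho> by (intro continuous_at_imp_continuous_on ballI has_derivative_continuous[OF der]) auto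
  \<comment> \<open>Maximise \<psi> minus c times the distance from \<open>p\<close> over the closed
    ball. The maximum cannot be at an interior point \<open>x\<close>: a move along
    \<open>e x\<close> raises \<psi> at rate 1 > c, while the distance grows at most at rate
    1.\<close>
  have sph: "\<exists>x\<in>sphere p \<rho>. \<psi> p + c * \<rho> \<le> \<psi> x" if c: "c < 1" "0 \<le> c" for c
  proof -
    have "continuous_on (cball p \<rho>) (\<lambda>y. \<psi> y - c * dist p y)" by (intro continuous_intros cont)
    then obtain x where x: "x \<in> cball p \<rho>"
      and mx: "\<And>y. y \<in> cball p \<rho> \<Longrightarrow> \<psi> y - c * dist p y \<le> \<psi> x - c * dist p x"
      using continuous_attains_sup[of "cball p \<rho>" "\<lambda>y. \<psi> y - c * dist p y"] \<rho> by auto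
    have "dist p x = \<rho>"
    proof (rule ccontr)
      assume "dist p x \<noteq> \<rho>"
      then have lt: "dist p x < \<rho>" using x by simp
      then have xb: "x \<in> ball p r" using \<rho> by simp
      have "((\<lambda>t. \<psi> (x + t *\<^sub>R e x) - c * t) has_real_derivative e (x + 0 *\<^sub>R e x) \<bullet> e x - c) (at 0)"
        by (intro DERIV_diff dir) (use xb in \<open>auto intro!: derivative_eq_intros\<close>)
      moreover have "e x \<bullet> e x - c > 0" using e[OF xb] c by (simp add: dot_square_norm)
      ultimately obtain d where d: "d > 0" "\<And>h. 0 < h \<Longrightarrow> h < d \<Longrightarrow> \<psi> x < \<psi> (x + h *\<^sub>R e x) - c * h"
        using DERIV_pos_inc_right[of "\<lambda>t. \<psi> (x + t *\<^sub>R e x) - c * t" "e x \<bullet> e x - c" 0] by auto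
      define h where "h = min (d/2) (\<rho> - dist p x)"
      have h: "0 < h" "h < d" "dist p x + h \<le> \<rho>" using d(1) lt by (auto simp: h_def)
      have tri: "dist p (x + h *\<^sub>R e x) \<le> dist p x + h"
        using dist_triangle[of p "x + h *\<^sub>R e x" x] e[OF xb] h by (simp add: dist_norm)
      have "\<psi> (x + h *\<^sub>R e x) - c * dist p (x + h *\<^sub>R e x) \<le> \<psi> x - c * dist p x"
        using tri h by (intro mx) auto
      moreover have "c * dist p (x + h *\<^sub>R e x) \<le> c * (dist p x + h)"
        using tri c by (intro mult_left_mono)
      ultimately show False using d(2)[OF h(1,2)] by (simp add: algebra_simps)
    qed
    then show ?thesis using mx[of p] \<rho> by (intro bexI[of _ x]) auto
  qed
  obtain y where y: "y \<in> sphere p \<rho>" "\<And>x. x \<in> sphere p \<rho> \<Longrightarrow> \<psi> x \<le> \<psi> y"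
  proof -
    have "sphere p \<rho> \<noteq> {}" using sph[of 0] by auto
    moreover have "continuous_on (sphere p \<rho>) \<psi>" using cont by (rule continuous_on_subset) auto
    ultimately show thesis using continuous_attains_sup[of "sphere p \<rho>" \<psi>] that by auto
  qed
  \<comment> \<open>This is the limit of the previous bound as c tends to 1: otherwise some c < 1
    would already exceed the slope from \<open>p\<close> to \<open>y\<close>.\<close>
  have y_ge: "\<psi> p + \<rho> \<le> \<psi> y"
  proof (rule ccontr)
    assume "\<not> \<psi> p + \<rho> \<le> \<psi> y"
    then have "(\<psi> y - \<psi> p) / \<rho> < 1" using \<rho> by simp
    then obtain c where c: "max 0 ((\<psi> y - \<psi> p) / \<rho>) < c" "c < 1"
      using dense[of "max 0 ((\<psi> y - \<psi> p) / \<rho>)" 1] by auto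
    then obtain x where "x \<in> sphere p \<rho>" "\<psi> p + c * \<rho> \<le> \<psi> x" using sph[of c] by auto
    then have "\<psi> p + c * \<rho> \<le> \<psi> y" using y by force
    moreover have "\<psi> y - \<psi> p < c * \<rho>" using c \<rho> by (simp add: pos_divide_less_eq)
    ultimately show False by simp
  qed
  define v where "v = (1/\<rho>) *\<^sub>R (y - p)"
  have v: "norm v = 1" "p + \<rho> *\<^sub>R v = y" using y \<rho> by (auto simp: v_def dist_norm norm_minus_commute)
  \<comment> \<open>\<open>f\<close> is nonincreasing by the Cauchy-Schwarz inequality and does not
    end below its initial value, so it is constant. Hence the derivative along the radius is 1, the
    equality case for two unit vectors.\<close>
  define f where "f = (\<lambda>t. \<psi> (p + t *\<^sub>R v) - t)"
  have inb: "p + s *\<^sub>R v \<in> ball p r" if "0 \<le> s" "s \<le> \<rho>" for s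
    using that v \<rho> by (simp add: dist_norm)
  have f': "(f has_real_derivative e (p + s *\<^sub>R v) \<bullet> v - 1) (at s)" if "0 \<le> s" "s \<le> \<rho>" for s
    unfolding f_def by (intro DERIV_diff dir inb that DERIV_ident)
  have le1: "e (p + s *\<^sub>R v) \<bullet> v \<le> 1" if "0 \<le> s" "s \<le> \<rho>" for s
    using norm_cauchy_schwarz[of "e (p + s *\<^sub>R v)" v] e[OF inb[OF that]] v by simp
  have dec: "f b \<le> f a" if "0 \<le> a" "a \<le> b" "b \<le> \<rho>" for a b
    using DERIV_nonpos_imp_nonincreasing[of a b f] f' le1 that by (metis (no_types, lifting) diff_le_0_iff_le order_trans)
  have f0: "f 0 \<le> f \<rho>" using y_ge v by (simp add: f_def)
  have ev: "e (p + s *\<^sub>R v) = v" if s: "0 \<le> s" "s < \<rho>" for s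
  proof -
    have "\<not> e (p + s *\<^sub>R v) \<bullet> v - 1 < 0"
    proof
      assume "e (p + s *\<^sub>R v) \<bullet> v - 1 < 0"
      from DERIV_neg_dec_right[OF f' this] s obtain d where d: "d > 0"
        "\<And>h. 0 < h \<Longrightarrow> h < d \<Longrightarrow> f (s + h) < f s" by auto
      define h where "h = min (d/2) (\<rho> - s)"
      have h: "0 < h" "h < d" "s + h \<le> \<rho>" using d(1) s by (auto simp: h_def)
      have "f \<rho> \<le> f (s + h)" "f s \<le> f 0" using h s by (auto intro!: dec)
      then show False using d(2)[OF h(1,2)] f0 by simp
    qed
    then have "e (p + s *\<^sub>R v) \<bullet> v = 1" using le1[of s] s by simp
    moreover have "norm (e (p + s *\<^sub>R v)) = 1" using e[OF inb] s by simp
    ultimately have "(norm (e (p + s *\<^sub>R v) - v))\<^sup>2 = 0"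
      using v unfolding dot_norm_neg by simp
    then show ?thesis by simp
  qed
  from ev[of 0] \<rho> have "e p = v" by simp
  with ev[OF t] show ?thesis by simp
qed

section \<open>Rays, complements of convex sets and difference quotients\<close>

lemma vecF_simps:
  "vecF (x + y) = vecF x + vecF y" "vecF (x - y) = vecF x - vecF y"
  "vecF (- x) = - vecF x" "vecF (c *\<^sub>R x) = c *\<^sub>R vecF x"
  "vecF (vecF x) = - x" "vecF x \<bullet> x = 0" "x \<bullet> vecF x = 0" "vecF x \<bullet> vecF y = x \<bullet> y"
  by (auto simp: vecF_def vec_eq_iff forall_2 inner_vec2)

lemma norm_vecF [simp]: "norm (vecF x) = norm x"
  by (simp add: norm_eq_sqrt_inner vecF_simps)

lemma continuous_on_vecF [continuous_intros]: "continuous_on S f \<Longrightarrow> continuous_on S (\<lambda>x. vecF (f x))"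
  unfolding vecF_def by (intro continuous_intros)

lemma vecF_expansion:
  assumes "norm e = 1"
  shows "y = (y \<bullet> e) *\<^sub>R e + (y \<bullet> vecF e) *\<^sub>R vecF e"
    "(y \<bullet> e)\<^sup>2 + (y \<bullet> vecF e)\<^sup>2 = (norm y)\<^sup>2"
proof -
  have 1: "e$1 * e$1 + e$2 * e$2 = 1"
    using assms dot_square_norm[of e] by (simp add: inner_vec2)
  have "y$1 = y$1 * (e$1 * e$1 + e$2 * e$2)" "y$2 = y$2 * (e$1 * e$1 + e$2 * e$2)"
    unfolding 1 by simp_all
  then show "y = (y \<bullet> e) *\<^sub>R e + (y \<bullet> vecF e) *\<^sub>R vecF e"
    by (simp add: vec_eq_iff forall_2 inner_vec2 vecF_def algebra_simps)
  have "(norm y)\<^sup>2 = (y$1 * y$1 + y$2 * y$2) * (e$1 * e$1 + e$2 * e$2)"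
    unfolding 1 by (simp add: power2_norm_eq_inner inner_vec2)
  then show "(y \<bullet> e)\<^sup>2 + (y \<bullet> vecF e)\<^sup>2 = (norm y)\<^sup>2"
    by (simp add: inner_vec2 vecF_def power2_eq_square algebra_simps)
qed

text \<open>The direction \<open>w n\<close> may vary with \<open>n\<close>, as it does when points
  on neighbouring lines are compared. Convergent directions are bounded, so the remainder in the
  definition of the derivative is still of smaller order than \<open>s n\<close>.\<close>

lemma has_derivative_tendsto_quotient:
  fixes f :: "'a::real_normed_vector \<Rightarrow> real"
  assumes f: "(f has_derivative f') (at z)"
    and s: "\<And>n. s n > 0" "s \<longlonglongrightarrow> 0" and w: "w \<longlonglongrightarrow> l"
  shows "(\<lambda>n. (f (z + s n *\<^sub>R w n) - f z) / s n) \<longlonglongrightarrow> f' l"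
proof -
  interpret f': bounded_linear f' using f by (rule has_derivative_bounded_linear)
  have "(\<lambda>n. (f (z + s n *\<^sub>R w n) - f z) / s n - f' (w n)) \<longlonglongrightarrow> 0"
  proof (rule LIMSEQ_I)
    fix r :: real assume r: "0 < r"
    define M where "M = norm l + 1"
    have M: "M > 0" by (simp add: M_def add_nonneg_pos)
    obtain d where d: "d > 0" "\<And>y. norm (y - z) < d \<Longrightarrow> norm (f y - f z - f' (y - z)) \<le> r / (2 * M) * norm (y - z)"
      using f r M unfolding has_derivative_at_alt by (metis divide_pos_pos mult_pos_pos zero_less_numeral)
    have "(\<lambda>n. norm (s n *\<^sub>R w n)) \<longlonglongrightarrow> norm (0 *\<^sub>R l)" by (intro tendsto_intros s w)
    then have "\<forall>\<^sub>F n in sequentially. norm (s n *\<^sub>R w n) < d" using d by (intro order_tendstoD) auto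
    moreover have "\<forall>\<^sub>F n in sequentially. norm (w n) < M"
      using tendsto_norm[OF w] by (rule order_tendstoD) (simp add: M_def)
    ultimately have "\<forall>\<^sub>F n in sequentially. norm ((f (z + s n *\<^sub>R w n) - f z) / s n - f' (w n) - 0) < r"
    proof eventually_elim
      case (elim n)
      have "norm (f (z + s n *\<^sub>R w n) - f z - f' (s n *\<^sub>R w n)) \<le> r / (2 * M) * norm (s n *\<^sub>R w n)"
        using d(2)[of "z + s n *\<^sub>R w n"] elim by simp
      also have "\<dots> = s n * (r / (2 * M) * norm (w n))" using s(1)[of n] by simp
      also have "\<dots> \<le> s n * (r / (2 * M) * M)"
        using s(1)[of n] r M elim by (intro mult_left_mono) auto
      also have "\<dots> = s n * (r / 2)" using M by simp
      also have "\<dots> < s n * r" using s(1)[of n] r by simp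
      finally have "\<bar>f (z + s n *\<^sub>R w n) - f z - s n * f' (w n)\<bar> / s n < r"
        using s(1)[of n] by (simp add: f'.scaleR pos_divide_less_eq mult.commute)
      moreover have "(f (z + s n *\<^sub>R w n) - f z) / s n - f' (w n)
          = (f (z + s n *\<^sub>R w n) - f z - s n * f' (w n)) / s n"
        using s(1)[of n] by (simp add: field_simps)
      ultimately show ?case using s(1)[of n] by (simp add: abs_divide)
    qed
    then show "\<exists>n0. \<forall>n\<ge>n0. norm ((f (z + s n *\<^sub>R w n) - f z) / s n - f' (w n) - 0) < r"
      by (simp add: eventually_sequentially)
  qed
  from tendsto_add[OF this f'.tendsto[OF w]] show ?thesis by simp
qed

lemma ray_exit:
  fixes x w :: "'a::euclidean_space"
  assumes U: "open U" "bounded U" "x \<in> U" and w: "norm w = 1"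
  obtains T where "T > 0" "\<And>t. 0 \<le> t \<Longrightarrow> t < T \<Longrightarrow> x + t *\<^sub>R w \<in> U" "x + T *\<^sub>R w \<notin> U"
proof -
  \<comment> \<open>The first exit time is the infimum of this set, attained because the set is
    closed; boundedness of \<open>U\<close> makes it nonempty.\<close>
  define E where "E = {t. 0 \<le> t \<and> x + t *\<^sub>R w \<notin> U}"
  have "closed ({0..} \<inter> (\<lambda>t. x + t *\<^sub>R w) -` (- U))"
    using U by (intro closed_Int closed_vimage continuous_intros) auto
  then have cl: "closed E" by (simp add: E_def Int_def vimage_def)
  obtain M where M: "\<And>y. y \<in> U \<Longrightarrow> norm y \<le> M" using U(2) by (auto simp: bounded_iff)
  have "x + (M + norm x + 1) *\<^sub>R w \<notin> U"
  proof
    assume "x + (M + norm x + 1) *\<^sub>R w \<in> U"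
    then have 1: "norm (x + (M + norm x + 1) *\<^sub>R w) \<le> M" by (rule M)
    have M0: "norm x \<le> M" "0 \<le> M" using M[OF U(3)] norm_ge_zero[of x] by linarith+
    have "M + norm x + 1 = norm ((M + norm x + 1) *\<^sub>R w)" unfolding norm_scaleR w mult_1_right real_norm_def
      using M0 norm_ge_zero[of x] by (intro abs_of_nonneg[symmetric]) linarith
    also have "\<dots> \<le> norm (x + (M + norm x + 1) *\<^sub>R w) + norm x"
      using norm_triangle_ineq4[of "x + (M + norm x + 1) *\<^sub>R w" x] by simp
    finally show False using 1 by simp
  qed
  moreover have "M + norm x + 1 \<ge> 0" using M[OF U(3)] norm_ge_zero[of x] by linarith
  ultimately have ne: "E \<noteq> {}" by (auto simp: E_def)
  have bd: "bdd_below E" by (auto simp: E_def bdd_below_def)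
  have T: "Inf E \<in> E" using closed_contains_Inf[OF ne bd cl] .
  show thesis
  proof (rule that[of "Inf E"])
    show "x + Inf E *\<^sub>R w \<notin> U" using T by (simp add: E_def)
    show "Inf E > 0" using T U(3) by (cases "Inf E = 0") (auto simp: E_def)
    show "x + t *\<^sub>R w \<in> U" if "0 \<le> t" "t < Inf E" for t
      using that cInf_lower[OF _ bd, of t] by (force simp: E_def)
  qed
qed

text \<open>By separation from \<open>K\<close>, the difference is the union of convex pieces
  \<open>P n\<close> over the unit vectors \<open>n\<close>. A separation of the difference would
  sort the connected pieces, and with them the unit vectors, into two disjoint open classes. This
  contradicts connectedness of the sphere in dimension at least 2.\<close>

lemma connected_diff_convex:
  fixes \<Omega> K :: "'a::euclidean_space set"
  assumes \<Omega>: "open \<Omega>" "convex \<Omega>" and K: "compact K" "convex K" "K \<subseteq> \<Omega>" "K \<noteq> {}"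
    and dim: "2 \<le> DIM('a)"
  shows "connected (\<Omega> - K)"
  unfolding connected_def
proof
  define P where "P = (\<lambda>n. {x \<in> \<Omega>. \<forall>y\<in>K. n \<bullet> y < n \<bullet> x})"
  have sup: "\<exists>y\<in>K. \<forall>z\<in>K. n \<bullet> z \<le> n \<bullet> y" for n
    by (rule continuous_attains_sup[OF K(1,4)]) (intro continuous_intros)
  have P_conv: "convex (P n)" for n
  proof -
    have "P n = \<Omega> \<inter> (\<Inter>y\<in>K. {x. n \<bullet> x > n \<bullet> y})" by (auto simp: P_def)
    then show ?thesis using \<Omega>(2) by (auto intro!: convex_Int convex_INT convex_halfspace_gt)
  qed
  have P_sub: "P n \<subseteq> \<Omega> - K" for n by (auto simp: P_def)
  have P_ne: "P n \<noteq> {}" if n: "norm n = 1" for n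
  proof -
    obtain y where y: "y \<in> K" "\<And>z. z \<in> K \<Longrightarrow> n \<bullet> z \<le> n \<bullet> y"
      using sup[of n] by blast
    then obtain r where r: "r > 0" "cball y r \<subseteq> \<Omega>" using \<Omega>(1) K(3) open_contains_cball by blast
    have "n \<bullet> z < n \<bullet> (y + r *\<^sub>R n)" if "z \<in> K" for z
      using y(2)[OF that] r n by (simp add: inner_add_right dot_square_norm)
    moreover have "y + r *\<^sub>R n \<in> \<Omega>" using r n by (auto simp: dist_norm)
    ultimately have "y + r *\<^sub>R n \<in> P n" by (simp add: P_def)
    then show ?thesis by auto
  qed
  have sep: "\<exists>n. norm n = 1 \<and> x \<in> P n" if x: "x \<in> \<Omega> - K" for x
  proof -
    obtain a b where ab: "a \<bullet> x < b" "\<And>y. y \<in> K \<Longrightarrow> b < a \<bullet> y"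
      using separating_hyperplane_closed_point[OF K(2) compact_imp_closed[OF K(1)]] x by (metis DiffD2)
    obtain y where "y \<in> K" using K by auto
    then have "a \<noteq> 0" using ab(1) ab(2)[of y] by auto
    have "a \<bullet> x < a \<bullet> y" if "y \<in> K" for y using ab(1) ab(2)[OF that] by linarith
    then have "x \<in> P ((- 1 / norm a) *\<^sub>R a)"
      using x \<open>a \<noteq> 0\<close> by (auto simp: P_def divide_strict_right_mono)
    then show ?thesis using \<open>a \<noteq> 0\<close> by (intro exI[of _ "(- 1 / norm a) *\<^sub>R a"]) auto
  qed
  have P_open: "\<exists>\<epsilon>>0. \<forall>m. dist m n < \<epsilon> \<longrightarrow> x \<in> P m" if x: "x \<in> P n" for x n
  proof -
    obtain y where y: "y \<in> K" "\<And>z. z \<in> K \<Longrightarrow> n \<bullet> z \<le> n \<bullet> y"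
      using sup[of n] by blast
    \<comment> \<open>The gap between \<open>x\<close> and \<open>K\<close> in direction
      \<open>n\<close>; a change of direction by less than \<open>g / R\<close> cannot close it,
      where \<open>R\<close> bounds the distance from \<open>x\<close> to the points of
      \<open>K\<close>.\<close>
    define g where "g = n \<bullet> x - n \<bullet> y"
    have g: "g > 0" using x y by (auto simp: P_def g_def)
    obtain M where M: "M > 0" "\<And>y. y \<in> K \<Longrightarrow> norm y \<le> M"
      using compact_imp_bounded[OF K(1)] by (auto simp: bounded_pos)
    define R where "R = M + norm x + 1"
    have R: "R > 0" using M norm_ge_zero[of x] by (simp add: R_def add_pos_nonneg)
    have "x \<in> P m" if m: "dist m n < g / R" for m
    proof -
      have "m \<bullet> z < m \<bullet> x" if z: "z \<in> K" for z
      proof -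
        have "\<bar>(m - n) \<bullet> (z - x)\<bar> \<le> norm (m - n) * norm (z - x)" by (rule Cauchy_Schwarz_ineq2)
        also have "\<dots> \<le> norm (m - n) * R"
          using norm_triangle_ineq4[of z x] M(2)[OF z] by (intro mult_left_mono) (auto simp: R_def)
        also have "\<dots> < g" using m R by (simp add: dist_norm pos_less_divide_eq)
        finally have "(m - n) \<bullet> (z - x) < g" by simp
        then show ?thesis using y(2)[OF z] by (simp add: g_def inner_diff)
      qed
      then show ?thesis using x by (auto simp: P_def)
    qed
    then show ?thesis using g R by (intro exI[of _ "g / R"]) auto
  qed
  assume "\<exists>e1 e2. open e1 \<and> open e2 \<and> \<Omega> - K \<subseteq> e1 \<union> e2 \<and> e1 \<inter> e2 \<inter> (\<Omega> - K) = {} \<and>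
    e1 \<inter> (\<Omega> - K) \<noteq> {} \<and> e2 \<inter> (\<Omega> - K) \<noteq> {}"
  then obtain e1 e2 where e: "open e1" "open e2" "\<Omega> - K \<subseteq> e1 \<union> e2" "e1 \<inter> e2 \<inter> (\<Omega> - K) = {}"
    "e1 \<inter> (\<Omega> - K) \<noteq> {}" "e2 \<inter> (\<Omega> - K) \<noteq> {}" by blast
  \<comment> \<open>The directions whose piece meets \<open>E\<close>. Connectedness of each piece
    keeps a direction from belonging to both classes.\<close>
  define Z where "Z = (\<lambda>E. {n. P n \<inter> E \<noteq> {}})"
  have Z_open: "open (Z E)" for E
    unfolding open_dist
  proof
    fix n assume "n \<in> Z E"
    then obtain x where "x \<in> P n" "x \<in> E" by (auto simp: Z_def)
    then show "\<exists>\<epsilon>>0. \<forall>m. dist m n < \<epsilon> \<longrightarrow> m \<in> Z E" using P_open[of x n] by (auto simp: Z_def)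
  qed
  have "sphere 0 1 \<subseteq> Z e1 \<union> Z e2"
  proof
    fix n :: 'a assume "n \<in> sphere 0 1"
    then have "P n \<noteq> {}" by (intro P_ne) auto
    then show "n \<in> Z e1 \<union> Z e2" using P_sub[of n] e(3) by (fastforce simp: Z_def)
  qed
  moreover have "Z e1 \<inter> Z e2 \<inter> sphere 0 1 = {}"
  proof -
    have "n \<notin> Z e1 \<inter> Z e2" for n
      using convex_connected[OF P_conv[of n]] P_sub[of n] e unfolding connected_def Z_def by blast
    then show ?thesis by auto
  qed
  moreover have "Z E \<inter> sphere 0 1 \<noteq> {}" if "E \<inter> (\<Omega> - K) \<noteq> {}" for E
    using that sep by (fastforce simp: Z_def)
  ultimately have "\<not> connected (sphere (0::'a) 1)"
    unfolding connected_def not_not using e(5,6) Z_open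
    by (intro exI[of _ "Z e1"] exI[of _ "Z e2"] conjI) auto
  with dim show False using connected_sphere by blast
qed

section \<open>Characteristic lines\<close>

text \<open>The weak condition is an equation here: for test functions supported away from the
  singular set the term with the norm of the gradient vanishes, and the inequality holds for both
  signs of the test function.\<close>

locale p_minimal_convex =
  fixes \<Omega> :: "(real^2) set" and u :: "real^2 \<Rightarrow> real"
  assumes open_dom: "open \<Omega>" and bounded_dom: "bounded \<Omega>" and convex_dom: "convex \<Omega>"
    and diff: "\<And>x. x \<in> \<Omega> \<Longrightarrow> u differentiable (at x)"
    and grad_cont: "continuous_on \<Omega> (grad u)"
    and weak: "\<And>\<phi>. test_function {x \<in> \<Omega>. grad u x + vecF x \<noteq> 0} \<phi> \<Longrightarrow>
      (LINT x|lborel. indicator {x \<in> \<Omega>. grad u x + vecF x \<noteq> 0} x *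
        ((1 / norm (grad u x + vecF x)) *\<^sub>R (grad u x + vecF x) \<bullet> grad \<phi> x)) = 0"
begin

definition V :: "real^2 \<Rightarrow> real^2" where "V x = grad u x + vecF x"
definition S where "S = {x \<in> \<Omega>. V x = 0}"
definition U where "U = {x \<in> \<Omega>. V x \<noteq> 0}"
text \<open>The direction of the characteristic line, chosen so that V = |V| J e. At zeros of
  \<open>V\<close> the convention 1/0 = 0 gives the value 0.\<close>

definition e where "e x = - vecF ((1 / norm (V x)) *\<^sub>R V x)"

lemma U_iff: "x \<in> U \<longleftrightarrow> x \<in> \<Omega> \<and> x \<notin> S" and S_sub: "S \<subseteq> \<Omega>"
  by (auto simp: U_def S_def)

lemma V_cont: "continuous_on \<Omega> V"
  unfolding V_def by (intro continuous_intros grad_cont)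

lemma V_tendsto: "f \<longlonglongrightarrow> x \<Longrightarrow> x \<in> \<Omega> \<Longrightarrow> (\<lambda>n. V (f n)) \<longlonglongrightarrow> V x"
  using isCont_tendsto_compose[of x V f] V_cont
  by (simp add: continuous_on_eq_continuous_at[OF open_dom])

lemma open_U: "open U"
proof -
  have "U = \<Omega> \<inter> V -` (- {0})" by (auto simp: U_def)
  then show ?thesis using V_cont open_dom continuous_on_open_vimage[OF open_dom] by (metis inf_commute open_Compl closed_singleton)
qed

lemma bounded_U: "bounded U"
  using bounded_dom by (rule bounded_subset) (auto simp: U_def)

lemma e_cont: "continuous_on U e"
  unfolding e_def by (intro continuous_intros continuous_on_subset[OF V_cont]) (auto simp: U_def)

lemma e_tendsto: "f \<longlonglongrightarrow> x \<Longrightarrow> x \<in> U \<Longrightarrow> (\<lambda>n. e (f n)) \<longlonglongrightarrow> e x"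
  using isCont_tendsto_compose[of x e f] e_cont
  by (simp add: continuous_on_eq_continuous_at[OF open_U])

lemma norm_e: "x \<in> U \<Longrightarrow> norm (e x) = 1"
  by (simp add: e_def U_def vecF_simps)

lemma V_eq: "V x = norm (V x) *\<^sub>R vecF (e x)"
  by (cases "V x = 0") (simp_all add: e_def vecF_simps)

lemma u_derivative: "x \<in> \<Omega> \<Longrightarrow> (u has_derivative (\<lambda>w. grad u x \<bullet> w)) (at x)"
proof -
  assume "x \<in> \<Omega>"
  then have d: "(u has_derivative frechet_derivative u (at x)) (at x)"
    using diff frechet_derivative_works by blast
  then interpret d: bounded_linear "frechet_derivative u (at x)" by (rule has_derivative_bounded_linear)
  have "frechet_derivative u (at x) w = grad u x \<bullet> w" for w
  proof -
    have "w = w$1 *\<^sub>R axis 1 1 + w$2 *\<^sub>R axis 2 1"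
      by (simp add: vec_eq_iff forall_2 axis_def)
    then have "frechet_derivative u (at x) w = frechet_derivative u (at x) (w$1 *\<^sub>R axis 1 1 + w$2 *\<^sub>R axis 2 1)"
      by simp
    also have "\<dots> = grad u x \<bullet> w"
      unfolding d.add d.scaleR by (simp add: grad_def inner_vec2)
    finally show ?thesis .
  qed
  then show ?thesis using d by presburger
qed

section \<open>Characteristic lines: \<open>e\<close> is constant and \<open>u\<close> is affine
  along them\<close>

lemma local_line:
  assumes x: "x \<in> U"
  obtains r where "r > 0" "\<And>t. \<bar>t\<bar> < r \<Longrightarrow> e (x + t *\<^sub>R e x) = e x"
proof -
  have c: "continuous_on U (\<lambda>x. (1 / norm (V x)) *\<^sub>R V x)"
    by (intro continuous_intros continuous_on_subset[OF V_cont]) (auto simp: U_def)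
  obtain r \<psi> where r: "r > 0" "ball x r \<subseteq> U"
    and \<psi>: "\<And>y. y \<in> ball x r \<Longrightarrow> (\<psi> has_derivative (\<lambda>w. - vecF ((1 / norm (V y)) *\<^sub>R V y) \<bullet> w)) (at y)"
  proof (rule local_potential[OF open_U c _ x])
    show "(LINT x|lborel. indicator U x * ((1 / norm (V x)) *\<^sub>R V x \<bullet> grad \<phi> x)) = 0"
      if "test_function U \<phi>" for \<phi>
      using weak[of \<phi>] that by (simp add: U_def V_def)
  qed blast
  have \<psi>: "(\<psi> has_derivative (\<lambda>w. e y \<bullet> w)) (at y)" if "y \<in> ball x r" for y
    using \<psi>[OF that] by (simp add: e_def)
  have n: "norm (e y) = 1" if "y \<in> ball x r" for y using that r norm_e by blast
  \<comment> \<open>The negated potential has the unit gradient -e; moving forward along it covers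
    negative \<open>t\<close>.\<close>
  have m: "((\<lambda>y. - \<psi> y) has_derivative (\<lambda>w. - e y \<bullet> w)) (at y)" if "y \<in> ball x r" for y
    using has_derivative_minus[OF \<psi>[OF that]] by simp
  show thesis
  proof (rule that[of "r / 2"])
    fix t assume t: "\<bar>t\<bar> < r / 2"
    show "e (x + t *\<^sub>R e x) = e x"
    proof (cases "t \<ge> 0")
      case True
      then show ?thesis using eikonal_line_forward[OF \<psi> n, of x r "r/2" t] t r by auto
    next
      case False
      then show ?thesis
        using eikonal_line_forward[OF m, of x r "r/2" "- t"] t r n by auto
    qed
  qed (use r in auto)
qed

text \<open>Continuation along the segment: the parameters at which \<open>e\<close> has its initial
  value form a set that is closed by continuity and open by \<open>local_line\<close>.\<close>

lemma e_const:
  assumes seg: "\<And>s. s \<in> closed_segment 0 t \<Longrightarrow> x + s *\<^sub>R e x \<in> U"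
  shows "e (x + t *\<^sub>R e x) = e x"
proof -
  let ?I = "closed_segment 0 t"
  have "continuous_on ?I (\<lambda>s. e (x + s *\<^sub>R e x))"
    by (rule continuous_on_compose2[OF e_cont]) (use seg in \<open>auto intro!: continuous_intros\<close>)
  moreover have "openin (top_of_set ?I) {s \<in> ?I. e (x + s *\<^sub>R e x) = e x}"
    unfolding openin_contains_ball
  proof (intro conjI ballI)
    fix s assume "s \<in> {s \<in> ?I. e (x + s *\<^sub>R e x) = e x}"
    then have s: "s \<in> ?I" "e (x + s *\<^sub>R e x) = e x" by auto
    obtain r where r: "r > 0" "\<And>h. \<bar>h\<bar> < r \<Longrightarrow> e ((x + s *\<^sub>R e x) + h *\<^sub>R e x) = e x"
      using local_line[OF seg[OF s(1)]] s(2) by metis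
    have "e (x + s' *\<^sub>R e x) = e x" if "s' \<in> ball s r" for s'
      using r(2)[of "s' - s"] that by (simp add: algebra_simps dist_norm abs_minus_commute)
    then show "\<exists>\<epsilon>>0. ball s \<epsilon> \<inter> ?I \<subseteq> {s \<in> ?I. e (x + s *\<^sub>R e x) = e x}" using r(1) by blast
  qed auto
  ultimately have "\<forall>s\<in>?I. e (x + s *\<^sub>R e x) = e x"
    by (intro continuous_levelset_openin[of ?I "\<lambda>s. e (x + s *\<^sub>R e x)"]) (auto intro!: bexI[of _ 0])
  then show ?thesis by simp
qed

text \<open>\<open>V\<close> is orthogonal to \<open>e\<close>, so the slope of \<open>u\<close>
  along the line is minus the component of \<open>vecF\<close> along \<open>e\<close>. This
  component is constant, since moving along \<open>e\<close> changes \<open>vecF\<close> only in the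
  direction orthogonal to \<open>e\<close>.\<close>

lemma u_affine:
  assumes seg: "\<And>s. s \<in> closed_segment 0 t \<Longrightarrow> x + s *\<^sub>R e x \<in> U"
  shows "u (x + t *\<^sub>R e x) = u x - t * (vecF x \<bullet> e x)"
proof -
  let ?I = "closed_segment 0 t"
  have "((\<lambda>s. u (x + s *\<^sub>R e x) + s * (vecF x \<bullet> e x)) has_field_derivative 0) (at s within ?I)"
    if s: "s \<in> ?I" for s
  proof -
    let ?y = "x + s *\<^sub>R e x"
    have y: "?y \<in> U" using seg[OF s] .
    have ey: "e ?y = e x"
      by (rule e_const) (use s seg in \<open>auto simp: closed_segment_eq_real_ivl split: if_splits\<close>)
    have "grad u ?y = norm (V ?y) *\<^sub>R vecF (e x) - vecF ?y"
      using V_eq[of ?y] unfolding ey by (simp add: V_def algebra_simps)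
    then have g: "grad u ?y \<bullet> e x = - (vecF x \<bullet> e x)"
      by (simp add: vecF_simps inner_diff_left inner_add_left)
    have "((\<lambda>s. x + s *\<^sub>R e x) has_derivative (\<lambda>h. h *\<^sub>R e x)) (at s)"
      by (auto intro!: derivative_eq_intros)
    from has_derivative_compose[OF this u_derivative] y
    have "((\<lambda>s. u (x + s *\<^sub>R e x)) has_field_derivative grad u ?y \<bullet> e x) (at s)"
      by (simp add: U_def has_field_derivative_def mult.commute[of _ "grad u ?y \<bullet> e x"])
    then have "((\<lambda>s. u (x + s *\<^sub>R e x) + s * (vecF x \<bullet> e x)) has_field_derivative 0) (at s)"
      using g by (auto intro!: derivative_eq_intros)
    then show ?thesis by (rule has_field_derivative_at_within)
  qed
  then have "\<exists>c. \<forall>s\<in>?I. u (x + s *\<^sub>R e x) + s * (vecF x \<bullet> e x) = c"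
    by (rule has_field_derivative_zero_constant[OF convex_closed_segment])
  then obtain c where c: "\<forall>s\<in>?I. u (x + s *\<^sub>R e x) + s * (vecF x \<bullet> e x) = c" ..
  from bspec[OF c, of 0] bspec[OF c, of t] show ?thesis by simp
qed

section \<open>Neighbouring lines and the size of \<open>V\<close> along a line\<close>

lemma line_stable:
  assumes ab: "a \<le> 0" "0 \<le> b" and line: "\<And>t. a \<le> t \<Longrightarrow> t \<le> b \<Longrightarrow> x + t *\<^sub>R e x \<in> U"
  shows "\<forall>\<^sub>F y in nhds x. \<forall>t\<in>{a..b}. y + t *\<^sub>R e y \<in> U"
proof -
  let ?K = "(\<lambda>t. x + t *\<^sub>R e x) ` {a..b}"
  have x: "x \<in> U" using line[of 0] ab by simp
  have K: "compact ?K" by (intro compact_continuous_image continuous_intros compact_Icc)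
  have cl: "closed (- U)" by (rule closed_Compl[OF open_U])
  have "?K \<subseteq> U" using line by (intro image_subsetI) simp
  then have KU: "?K \<inter> - U = {}" by blast
  obtain d where d: "d > 0" "\<And>y z. y \<in> ?K \<Longrightarrow> z \<notin> U \<Longrightarrow> d \<le> dist y z"
    using separate_compact_closed[OF K cl KU] by (metis ComplI)
  \<comment> \<open>A bound for |t| on the segment, positive even for \<open>a = b = 0\<close>. It
    decides how close \<open>e y\<close> must be to \<open>e x\<close>.\<close>
  define M where "M = max (- a) b + 1"
  have M: "M > 0" using ab by (simp add: M_def)
  have "isCont e x" using e_cont open_U x continuous_on_eq_continuous_at by blast
  then have "(e \<longlongrightarrow> e x) (nhds x)" by (simp add: isCont_def tendsto_at_iff_tendsto_nhds)
  then have "\<forall>\<^sub>F y in nhds x. dist (e y) (e x) < d / (2 * M)"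
    using d M by (intro tendstoD) auto
  moreover have "\<forall>\<^sub>F y in nhds x. dist y x < d / 2"
    unfolding eventually_nhds_metric using d(1) by (intro exI[of _ "d / 2"]) auto
  ultimately show ?thesis
  proof eventually_elim
    case (elim y)
    show ?case
    proof (rule ballI, rule ccontr)
      fix t assume t: "t \<in> {a..b}" and "y + t *\<^sub>R e y \<notin> U"
      then have "d \<le> dist (x + t *\<^sub>R e x) (y + t *\<^sub>R e y)" using d(2) by blast
      also have "\<dots> \<le> dist x y + \<bar>t\<bar> * dist (e x) (e y)"
        using norm_triangle_ineq[of "x - y" "t *\<^sub>R (e x - e y)"]
        unfolding dist_norm norm_scaleR by (simp add: algebra_simps)
      also have "\<dots> \<le> dist x y + M * dist (e x) (e y)"
        using t ab by (intro add_left_mono mult_right_mono) (auto simp: M_def)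
      also have "\<dots> < d / 2 + M * (d / (2 * M))"
        using elim M by (intro add_strict_mono mult_strict_left_mono) (auto simp: dist_commute)
      also have "\<dots> = d" using M by simp
      finally show False by simp
    qed
  qed
qed

text \<open>The slope of \<open>u\<close> across the line is found by comparing its affine values on
  the line of \<open>x\<close> and on the lines of nearby points \<open>q n\<close> on the normal.
  The number \<open>k\<close> is the rate at which \<open>e\<close> turns towards the normal, taken
  as a limit along a subsequence because \<open>e\<close> is only known to be continuous. The factor
  1 + kt measures the spreading of neighbouring lines.\<close>

lemma V_on_line:
  assumes x: "x \<in> U" and t: "t1 < 0" "0 < t2"
    and line: "\<And>t. t1 < t \<Longrightarrow> t < t2 \<Longrightarrow> x + t *\<^sub>R e x \<in> U"
  obtains k where "\<And>t. t1 < t \<Longrightarrow> t < t2 \<Longrightarrow> 0 < 1 + k * t \<and>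
    norm (V (x + t *\<^sub>R e x)) * (1 + k * t) = norm (V x) + 2 * t + k * t\<^sup>2"
proof -
  define N where "N = vecF (e x)"
  define s where "s = (\<lambda>n. inverse (real (Suc n)))"
  define q where "q = (\<lambda>n. x + s n *\<^sub>R N)"
  define c where "c = (\<lambda>n. e (q n) \<bullet> e x)"
  define m where "m = (\<lambda>n. e (q n) \<bullet> N)"
  define \<mu> where "\<mu> = (\<lambda>n. m n / s n)"
  have ee: "e x \<bullet> e x = 1" "N \<bullet> N = 1" "e x \<bullet> N = 0" "N \<bullet> e x = 0" "vecF N = - e x" "vecF (e x) = N"
    using norm_e[OF x] by (simp_all add: N_def vecF_simps dot_square_norm)
  have s: "s n > 0" for n by (simp add: s_def)
  have s0: "s \<longlonglongrightarrow> 0" unfolding s_def by (rule LIMSEQ_inverse_real_of_nat)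
  have "q \<longlonglongrightarrow> x + 0 *\<^sub>R N" unfolding q_def by (intro tendsto_intros s0)
  then have q: "q \<longlonglongrightarrow> x" by simp
  have eq: "(\<lambda>n. e (q n)) \<longlonglongrightarrow> e x" by (rule e_tendsto[OF q x])
  have qU: "\<forall>\<^sub>F n in sequentially. q n \<in> U" using q open_U x by (rule topological_tendstoD)
  have c1: "c \<longlonglongrightarrow> 1" using tendsto_inner[OF eq tendsto_const[of "e x"]] by (simp add: c_def ee)
  have m0: "m \<longlonglongrightarrow> 0" using tendsto_inner[OF eq tendsto_const[of N]] by (simp add: m_def ee)
  have expand: "e (q n) = c n *\<^sub>R e x + m n *\<^sub>R N" for n
    using vecF_expansion(1)[OF norm_e[OF x], of "e (q n)"] by (simp add: c_def m_def N_def)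
  have cm: "(c n)\<^sup>2 + (m n)\<^sup>2 = 1" if "q n \<in> U" for n
    using vecF_expansion(2)[OF norm_e[OF x], of "e (q n)"] norm_e[OF that] by (simp add: c_def m_def N_def)
  have seg: "\<forall>\<^sub>F n in sequentially. \<forall>\<tau>\<in>closed_segment 0 t. q n + \<tau> *\<^sub>R e (q n) \<in> U"
    if "t1 < t" "t < t2" for t
  proof -
    have "\<forall>\<^sub>F y in nhds x. \<forall>\<tau>\<in>{min 0 t..max 0 t}. y + \<tau> *\<^sub>R e y \<in> U"
      by (rule line_stable) (use that t in \<open>auto intro!: line\<close>)
    then have "\<forall>\<^sub>F n in sequentially. \<forall>\<tau>\<in>{min 0 t..max 0 t}. q n + \<tau> *\<^sub>R e (q n) \<in> U"
      using q unfolding filterlim_iff by blast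
    moreover have "closed_segment 0 t \<subseteq> {min 0 t..max 0 t}"
      by (simp add: closed_segment_eq_real_ivl)
    ultimately show ?thesis by (auto elim!: eventually_mono)
  qed
  text \<open>Two characteristic lines do not cross inside \<open>U\<close>, since \<open>e\<close> is constant along each of them.\<close>
  have pos: "\<forall>\<^sub>F n in sequentially. 0 < 1 + t * \<mu> n" if tt: "t1 < t" "t < t2" for t
    using seg[OF tt] qU order_tendstoD(1)[OF c1 zero_less_one]
  proof eventually_elim
    case (elim n)
    have c_le: "c n \<le> 1"
    proof -
      have "(c n)\<^sup>2 \<le> 1" using cm[OF elim(2)] zero_le_power2[of "m n"] by linarith
      then show ?thesis using power2_le_imp_le[of "c n" 1] by simp
    qed
    show ?case
    proof (rule ccontr)
      assume "\<not> 0 < 1 + t * \<mu> n"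
      then have le: "t * \<mu> n \<le> -1" by simp
      \<comment> \<open>The parameter at which the neighbouring line meets the line of
        \<open>x\<close>: its normal coordinate \<open>s n + \<tau> * m n\<close> vanishes.\<close>
      define \<tau> where "\<tau> = - 1 / \<mu> n"
      have \<mu>0: "\<mu> n \<noteq> 0" using le by auto
      have \<tau>: "\<tau> \<in> closed_segment 0 t"
      proof (cases "\<mu> n > 0")
        case True
        have "t \<le> \<tau>" using pos_le_divide_eq[OF True, of t "-1"] le by (simp add: \<tau>_def)
        moreover have "\<tau> < 0" using True by (simp add: \<tau>_def)
        ultimately show ?thesis by (auto simp: closed_segment_eq_real_ivl)
      next
        case False
        then have F: "\<mu> n < 0" using \<mu>0 by simp
        have "\<tau> \<le> t" using neg_divide_le_eq[OF F, of "-1" t] le by (simp add: \<tau>_def)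
        moreover have "0 < \<tau>" using F by (simp add: \<tau>_def)
        ultimately show ?thesis by (auto simp: closed_segment_eq_real_ivl)
      qed
      have mm: "s n + \<tau> * m n = 0" using \<mu>0 s[of n] by (auto simp: \<tau>_def \<mu>_def field_simps)
      have meet: "q n + \<tau> *\<^sub>R e (q n) = x + (\<tau> * c n) *\<^sub>R e x"
      proof -
        have "q n + \<tau> *\<^sub>R e (q n) = x + (\<tau> * c n) *\<^sub>R e x + (s n + \<tau> * m n) *\<^sub>R N"
          unfolding expand by (simp add: q_def algebra_simps)
        then show ?thesis by (simp add: mm)
      qed
      have sub: "closed_segment 0 \<tau> \<subseteq> closed_segment 0 t"
        using \<tau> by (simp add: subset_closed_segment)
      \<comment> \<open>Since 0 < \<open>c n\<close> \<le> 1, the meeting point also lies on the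
        controlled part of the line of \<open>x\<close>.\<close>
      have "\<tau> * c n \<in> closed_segment 0 \<tau>"
        using elim(3) c_le by (auto simp: closed_segment_def intro!: exI[of _ "c n"])
      then have "closed_segment 0 (\<tau> * c n) \<subseteq> closed_segment 0 t"
        using sub by (meson closed_segment_subset convex_closed_segment ends_in_segment(1) subsetD)
      moreover have "y \<in> closed_segment 0 t \<Longrightarrow> t1 < y \<and> y < t2" for y
        using tt t by (auto simp: closed_segment_eq_real_ivl split: if_splits)
      ultimately have "e (x + (\<tau> * c n) *\<^sub>R e x) = e x" by (intro e_const line) auto
      moreover have "e (q n + \<tau> *\<^sub>R e (q n)) = e (q n)" using elim(1) sub by (intro e_const) auto
      ultimately have "e (q n) = e x" using meet by simp
      then have "m n = 0" by (simp add: m_def ee)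
      then show False using mm s[of n] by simp
    qed
  qed
  obtain r k where r: "filterlim r at_top sequentially" and k: "(\<lambda>n. \<mu> (r n)) \<longlonglongrightarrow> k"
  proof -
    \<comment> \<open>Not crossing at t1/2 and at t2/2 bounds the turning rates from both sides, so
      a subsequence converges.\<close>
    have "\<forall>\<^sub>F n in sequentially. 0 < 1 + t1/2 * \<mu> n" "\<forall>\<^sub>F n in sequentially. 0 < 1 + t2/2 * \<mu> n"
      by (rule pos; use t in simp)+
    then have "\<forall>\<^sub>F n in sequentially. \<mu> n \<in> {-2/t2..-2/t1}"
    proof eventually_elim
      case (elim n)
      then show ?case
        using pos_divide_le_eq[OF t(2), of "-2" "\<mu> n"] neg_le_divide_eq[OF t(1), of "\<mu> n" "-2"]
        by (simp add: mult.commute)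
    qed
    then obtain n0 where n0: "\<And>n. n \<ge> n0 \<Longrightarrow> \<mu> n \<in> {-2/t2..-2/t1}"
      by (auto simp: eventually_sequentially)
    have "seq_compact {-2/t2..-2/t1}" by (intro compact_imp_seq_compact compact_Icc)
    moreover have "\<forall>n. \<mu> (n + n0) \<in> {-2/t2..-2/t1}" using n0 by simp
    ultimately obtain k r where r: "strict_mono r" "((\<lambda>n. \<mu> (n + n0)) \<circ> r) \<longlonglongrightarrow> k"
      by (rule seq_compactE)
    show thesis
    proof (rule that[of "\<lambda>n. r n + n0" k])
      show "filterlim (\<lambda>n. r n + n0) at_top sequentially"
        using filterlim_compose[OF filterlim_add_const_nat_at_top filterlim_subseq[OF r(1)]] .
    qed (use r(2) in \<open>simp add: o_def\<close>)
  qed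
  have sub: "\<forall>\<^sub>F n in sequentially. P (r n)" if "\<forall>\<^sub>F n in sequentially. P n" for P
    using that r unfolding filterlim_iff by blast
  have lims: "(\<lambda>n. s (r n)) \<longlonglongrightarrow> 0" "(\<lambda>n. c (r n)) \<longlonglongrightarrow> 1" "(\<lambda>n. m (r n)) \<longlonglongrightarrow> 0"
    using filterlim_compose[OF s0 r] filterlim_compose[OF c1 r] filterlim_compose[OF m0 r] by auto
  have eqr: "(\<lambda>n. e (q (r n))) \<longlonglongrightarrow> e x" using filterlim_compose[OF eq r] .
  \<comment> \<open>The tangential change is of second order: c^2 + m^2 = 1 gives (c - 1)(1 + c) =
    -m^2, while m/s stays bounded and m tends to 0.\<close>
  have c_quot: "(\<lambda>n. (c (r n) - 1) / s (r n)) \<longlonglongrightarrow> 0"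
  proof -
    have "(\<lambda>n. - (\<mu> (r n) * m (r n) / (1 + c (r n)))) \<longlonglongrightarrow> - (k * 0 / (1 + 1))"
      by (intro tendsto_intros k lims) auto
    moreover have "\<forall>\<^sub>F n in sequentially. - (\<mu> (r n) * m (r n) / (1 + c (r n))) = (c (r n) - 1) / s (r n)"
      using sub[OF qU] order_tendstoD(1)[OF lims(2) zero_less_one]
    proof eventually_elim
      case (elim n)
      have "(c (r n) - 1) * (1 + c (r n)) = - (m (r n))\<^sup>2"
        using cm[OF elim(1)] by (simp add: algebra_simps power2_eq_square)
      moreover have "1 + c (r n) \<noteq> 0" using elim(2) by simp
      ultimately have eq: "c (r n) - 1 = - (m (r n))\<^sup>2 / (1 + c (r n))"
        by (subst nonzero_eq_divide_eq)
      show ?case unfolding eq \<mu>_def by (simp add: power2_eq_square mult.commute)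
    qed
    ultimately show ?thesis by (auto intro: Lim_transform_eventually)
  qed
  have e_quot: "(\<lambda>n. (1 / s (r n)) *\<^sub>R (e (q (r n)) - e x)) \<longlonglongrightarrow> k *\<^sub>R N"
  proof -
    have "(\<lambda>n. ((c (r n) - 1) / s (r n)) *\<^sub>R e x + \<mu> (r n) *\<^sub>R N) \<longlonglongrightarrow> 0 *\<^sub>R e x + k *\<^sub>R N"
      by (intro tendsto_intros c_quot k)
    moreover have "((c (r n) - 1) / s (r n)) *\<^sub>R e x + \<mu> (r n) *\<^sub>R N
        = (1 / s (r n)) *\<^sub>R (e (q (r n)) - e x)" for n
    proof -
      have "e (q (r n)) - e x = (c (r n) - 1) *\<^sub>R e x + m (r n) *\<^sub>R N"
        by (subst expand) (simp add: algebra_simps)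
      then show ?thesis by (simp add: \<mu>_def scaleR_add_right)
    qed
    ultimately show ?thesis by simp
  qed
  \<comment> \<open>Two evaluations of one limit. The points at parameter \<open>t\<close> on the
    two lines differ by \<open>s (r n)\<close> times a vector tending to (1 + tk) N, so
    differentiability of \<open>u\<close> gives the left side. Affinity of \<open>u\<close> on both
    lines reduces the same quotient to data at \<open>x\<close> and gives the right side.\<close>
  have main: "(V (x + t *\<^sub>R e x) - vecF (x + t *\<^sub>R e x)) \<bullet> ((1 + t * k) *\<^sub>R N)
      = (V x - vecF x) \<bullet> N - t * (- 1 + k * (vecF x \<bullet> N))" if tt: "t1 < t" "t < t2" for t
  proof (rule LIMSEQ_unique)
    let ?y = "x + t *\<^sub>R e x"
    define w where "w = (\<lambda>n. N + t *\<^sub>R ((1 / s (r n)) *\<^sub>R (e (q (r n)) - e x)))"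
    have w: "w \<longlonglongrightarrow> (1 + t * k) *\<^sub>R N"
      using tendsto_add[OF tendsto_const[of N] tendsto_scaleR[OF tendsto_const[of t] e_quot]]
      by (simp add: w_def scaleR_add_left)
    have yw: "?y + s (r n) *\<^sub>R w n = q (r n) + t *\<^sub>R e (q (r n))" for n
      using s[of "r n"] by (simp add: w_def q_def algebra_simps)
    have y: "?y \<in> \<Omega>" using line[OF tt] by (simp add: U_iff)
    have gy: "grad u z = V z - vecF z" for z by (simp add: V_def)
    from has_derivative_tendsto_quotient[OF u_derivative[OF y] _ lims(1) w] s
    show "(\<lambda>n. (u (q (r n) + t *\<^sub>R e (q (r n))) - u ?y) / s (r n))
        \<longlonglongrightarrow> (V ?y - vecF ?y) \<bullet> ((1 + t * k) *\<^sub>R N)"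
      unfolding yw gy by blast
    have x': "x \<in> \<Omega>" using x by (simp add: U_iff)
    have "(\<lambda>n. (u (x + s (r n) *\<^sub>R N) - u x) / s (r n)) \<longlonglongrightarrow> grad u x \<bullet> N"
      by (rule has_derivative_tendsto_quotient[OF u_derivative[OF x'] _ lims(1) tendsto_const]) (rule s)
    then have 1: "(\<lambda>n. (u (q (r n)) - u x) / s (r n)) \<longlonglongrightarrow> (V x - vecF x) \<bullet> N"
      by (simp add: q_def gy)
    have "(\<lambda>n. (u (q (r n)) - u x) / s (r n) - t * (- (e x \<bullet> e (q (r n)))
        + vecF x \<bullet> ((1 / s (r n)) *\<^sub>R (e (q (r n)) - e x))))
      \<longlonglongrightarrow> (V x - vecF x) \<bullet> N - t * (- (e x \<bullet> e x) + vecF x \<bullet> (k *\<^sub>R N))"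
      by (intro tendsto_intros 1 eqr e_quot)
    moreover have "\<forall>\<^sub>F n in sequentially. (u (q (r n)) - u x) / s (r n) - t * (- (e x \<bullet> e (q (r n)))
        + vecF x \<bullet> ((1 / s (r n)) *\<^sub>R (e (q (r n)) - e x)))
      = (u (q (r n) + t *\<^sub>R e (q (r n))) - u ?y) / s (r n)"
      using sub[OF seg[OF tt]]
    proof eventually_elim
      case (elim n)
      have 2: "u (q (r n) + t *\<^sub>R e (q (r n))) = u (q (r n)) - t * (vecF (q (r n)) \<bullet> e (q (r n)))"
        using elim by (intro u_affine) auto
      have 3: "u ?y = u x - t * (vecF x \<bullet> e x)"
        using tt t by (intro u_affine line) (auto simp: closed_segment_eq_real_ivl split: if_splits)
      have vq: "vecF (q (r n)) = vecF x - s (r n) *\<^sub>R e x"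
        by (simp add: q_def vecF_simps ee)
      have "u (q (r n) + t *\<^sub>R e (q (r n))) - u ?y
         = (u (q (r n)) - u x) - t * (- s (r n) * (e x \<bullet> e (q (r n))) + vecF x \<bullet> (e (q (r n)) - e x))"
        unfolding 2 3 vq by (simp add: inner_diff_left inner_diff_right algebra_simps)
      then show ?case using s[of "r n"]
        by (simp add: diff_divide_distrib add_divide_distrib distrib_left) (simp add: field_simps)
    qed
    ultimately show "(\<lambda>n. (u (q (r n) + t *\<^sub>R e (q (r n))) - u ?y) / s (r n))
        \<longlonglongrightarrow> (V x - vecF x) \<bullet> N - t * (- 1 + k * (vecF x \<bullet> N))"
      by (auto simp: ee intro: Lim_transform_eventually)
  qed
  have ge0: "0 \<le> 1 + t * k" if "t1 < t" "t < t2" for t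
  proof (rule tendsto_lowerbound)
    show "(\<lambda>n. 1 + t * \<mu> (r n)) \<longlonglongrightarrow> 1 + t * k" by (intro tendsto_intros k)
    show "\<forall>\<^sub>F n in sequentially. 0 \<le> 1 + t * \<mu> (r n)"
      using sub[OF pos[OF that]] by eventually_elim simp
  qed simp
  show thesis
  proof (rule that[of k], intro conjI)
    fix t assume tt: "t1 < t" "t < t2"
    \<comment> \<open>An affine function that is nonnegative on an open interval and has nonzero
      slope cannot vanish inside: it would be negative beyond the zero, here at the midpoint between
      \<open>t\<close> and an endpoint.\<close>
    show "0 < 1 + k * t"
    proof (rule ccontr)
      assume "\<not> 0 < 1 + k * t"
      then have kt: "t * k = -1" using ge0[OF tt] by (simp add: mult.commute)
      show False
      proof (cases "t > 0")
        case True
        then have "k < 0" using kt mult_nonneg_nonneg[of t k] by linarith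
        then have "(t + t2) / 2 * k < t * k"
          using tt by (intro mult_strict_right_mono_neg) auto
        then show False using ge0[of "(t + t2) / 2"] tt t kt by simp
      next
        case False
        then have "t < 0" using kt by (cases "t = 0") auto
        then have "k > 0" using kt mult_nonpos_nonpos[of t k] by linarith
        then have "(t + t1) / 2 * k < t * k"
          using tt by (intro mult_strict_right_mono) auto
        then show False using ge0[of "(t + t1) / 2"] tt t kt by simp
      qed
    qed
    let ?y = "x + t *\<^sub>R e x"
    have "e ?y = e x"
      using tt t by (intro e_const line) (auto simp: closed_segment_eq_real_ivl split: if_splits)
    then have Vy: "V ?y \<bullet> N = norm (V ?y)" using V_eq[of ?y] ee by (metis N_def inner_scaleR_left mult.right_neutral)
    have Vx: "V x \<bullet> N = norm (V x)" using V_eq[of x] ee by (metis N_def inner_scaleR_left mult.right_neutral)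
    have "vecF ?y \<bullet> N = vecF x \<bullet> N + t" by (simp add: vecF_simps ee inner_add_left)
    then have "(norm (V ?y) - (vecF x \<bullet> N + t)) * (1 + t * k)
       = norm (V x) - vecF x \<bullet> N - t * (- 1 + k * (vecF x \<bullet> N))"
      using main[OF tt] by (simp add: inner_diff_left Vx Vy mult.commute)
    then show "norm (V ?y) * (1 + k * t) = norm (V x) + 2 * t + k * t\<^sup>2"
      by (simp add: algebra_simps power2_eq_square)
  qed
qed

text \<open>The formula of \<open>V_on_line\<close> is continued to an endpoint of the interval,
  where \<open>V\<close> vanishes; the positive factor becomes nonnegative in the limit.\<close>

lemma line_end:
  assumes x: "x \<in> U" and t: "t1 < 0" "0 < t2"
    and line: "\<And>t. t1 < t \<Longrightarrow> t < t2 \<Longrightarrow> x + t *\<^sub>R e x \<in> U"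
    and \<tau>: "\<tau> = t1 \<or> \<tau> = t2" "x + \<tau> *\<^sub>R e x \<in> S"
  obtains k where "0 \<le> 1 + k * \<tau>" "norm (V x) + 2 * \<tau> + k * \<tau>\<^sup>2 = 0"
proof -
  obtain k where k: "\<And>t. t1 < t \<Longrightarrow> t < t2 \<Longrightarrow> 0 < 1 + k * t \<and>
    norm (V (x + t *\<^sub>R e x)) * (1 + k * t) = norm (V x) + 2 * t + k * t\<^sup>2"
    using V_on_line[OF x t line] by blast
  \<comment> \<open>The double successor keeps \<open>b n\<close> strictly between 0 and 1, starting
    from 1/2.\<close>
  define b where "b = (\<lambda>n. 1 - inverse (real (Suc (Suc n))))"
  have "(\<lambda>n. inverse (real (Suc (Suc n)))) \<longlonglongrightarrow> 0"
    using LIMSEQ_Suc[OF LIMSEQ_inverse_real_of_nat] .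
  then have b1: "b \<longlonglongrightarrow> 1" unfolding b_def by (auto intro: tendsto_eq_intros)
  have b: "0 < b n" "b n < 1" for n by (auto simp: b_def field_simps)
  define f where "f = (\<lambda>n. \<tau> * b n)"
  have f: "f \<longlonglongrightarrow> \<tau>" using tendsto_mult[OF tendsto_const[of \<tau>] b1] by (simp add: f_def)
  have fI: "t1 < f n" "f n < t2" for n
  proof -
    have "t1 < t1 * b n" "t2 * b n < t2" "0 < t2 * b n" "t1 * b n < 0"
      using b[of n] t by (auto simp: mult_neg_pos)
    then show "t1 < f n" "f n < t2" using \<tau>(1) t by (auto simp: f_def)
  qed
  have S: "x + \<tau> *\<^sub>R e x \<in> \<Omega>" "V (x + \<tau> *\<^sub>R e x) = 0" using \<tau>(2) by (auto simp: S_def)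
  have "(\<lambda>n. V (x + f n *\<^sub>R e x)) \<longlonglongrightarrow> V (x + \<tau> *\<^sub>R e x)"
    by (rule V_tendsto[OF _ S(1)]) (intro tendsto_intros f)
  then have "(\<lambda>n. norm (V (x + f n *\<^sub>R e x)) * (1 + k * f n)) \<longlonglongrightarrow> norm (V (x + \<tau> *\<^sub>R e x)) * (1 + k * \<tau>)"
    by (intro tendsto_intros f)
  moreover have "(\<lambda>n. norm (V x) + 2 * f n + k * (f n)\<^sup>2) \<longlonglongrightarrow> norm (V x) + 2 * \<tau> + k * \<tau>\<^sup>2"
    by (intro tendsto_intros f)
  ultimately have "norm (V x) + 2 * \<tau> + k * \<tau>\<^sup>2 = 0"
    using k[OF fI] S(2) LIMSEQ_unique by fastforce
  moreover have "0 \<le> 1 + k * \<tau>"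
  proof (rule tendsto_lowerbound)
    show "(\<lambda>n. 1 + k * f n) \<longlonglongrightarrow> 1 + k * \<tau>" by (intro tendsto_intros f)
    show "\<forall>\<^sub>F n in sequentially. 0 \<le> 1 + k * f n" using k[OF fI] by (simp add: less_imp_le)
  qed simp
  ultimately show thesis by (intro that)
qed

lemma short_line:
  assumes "x \<in> U"
  obtains \<eta> where "\<eta> > 0" "\<And>t. \<bar>t\<bar> < \<eta> \<Longrightarrow> x + t *\<^sub>R e x \<in> U"
proof -
  obtain \<eta> where \<eta>: "\<eta> > 0" "ball x \<eta> \<subseteq> U" using open_U assms open_contains_ball by blast
  show thesis
  proof (rule that[OF \<eta>(1)])
    fix t :: real assume "\<bar>t\<bar> < \<eta>"
    then have "x + t *\<^sub>R e x \<in> ball x \<eta>" using norm_e[OF assms] by (simp add: dist_norm)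
    then show "x + t *\<^sub>R e x \<in> U" using \<eta>(2) by blast
  qed
qed

text \<open>At a singular endpoint |V x| + 2T + kT^2 = 0, yet multiplying 1 + kT \<ge> 0 by T shows
  that the left side is at least T > 0.\<close>

lemma forward_end_notin_S:
  assumes x: "x \<in> U" and T: "0 < T" and line: "\<And>t. 0 \<le> t \<Longrightarrow> t < T \<Longrightarrow> x + t *\<^sub>R e x \<in> U"
  shows "x + T *\<^sub>R e x \<notin> S"
proof
  assume hit: "x + T *\<^sub>R e x \<in> S"
  obtain \<eta> where \<eta>: "\<eta> > 0" "\<And>t. \<bar>t\<bar> < \<eta> \<Longrightarrow> x + t *\<^sub>R e x \<in> U" using short_line[OF x] by blast
  have l: "x + t *\<^sub>R e x \<in> U" if "- \<eta> < t" "t < T" for t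
    using that line \<eta>(2)[of t] by (cases "t \<ge> 0") auto
  obtain k where k: "0 \<le> 1 + k * T" "norm (V x) + 2 * T + k * T\<^sup>2 = 0"
    by (rule line_end[OF x _ T l _ hit, of "- \<eta>"]) (use \<eta> in auto)
  have "0 \<le> T * (1 + k * T)" using k T by simp
  then have "0 \<le> T + k * T\<^sup>2" by (simp add: algebra_simps power2_eq_square)
  then show False using k(2) T norm_ge_zero[of "V x"] by linarith
qed

text \<open>At the endpoint -T one has |V x| = 2T - kT^2, and 1 - kT \<ge> 0 gives kT^2 \<le>
  T.\<close>

lemma backward_end_bound:
  assumes x: "x \<in> U" and T: "0 < T" and line: "\<And>t. 0 \<le> t \<Longrightarrow> t < T \<Longrightarrow> x - t *\<^sub>R e x \<in> U"
    and hit: "x - T *\<^sub>R e x \<in> S"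
  shows "T \<le> norm (V x)"
proof -
  obtain \<eta> where \<eta>: "\<eta> > 0" "\<And>t. \<bar>t\<bar> < \<eta> \<Longrightarrow> x + t *\<^sub>R e x \<in> U" using short_line[OF x] by blast
  have l: "x + t *\<^sub>R e x \<in> U" if "- T < t" "t < \<eta>" for t
    using that line[of "- t"] \<eta>(2)[of t] by (cases "t \<le> 0") auto
  obtain k where k: "0 \<le> 1 + k * (- T)" "norm (V x) + 2 * (- T) + k * (- T)\<^sup>2 = 0"
    by (rule line_end[OF x _ \<eta>(1) l, of "- T" "- T"]) (use T hit in auto)
  have "0 \<le> T * (1 + k * (- T))" using k T by simp
  then have "0 \<le> T - k * T\<^sup>2" by (simp add: algebra_simps power2_eq_square)
  then show ?thesis using k(2) by simp
qed

text \<open>For \<tau> strictly between |V x| and \<delta> the formula at -\<tau> yields |V x| \<ge>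
  2\<tau> - k\<tau>^2, while positivity of 1 - k\<tau> makes the right side larger than
  \<tau>.\<close>

lemma long_line_bound:
  assumes \<delta>: "0 < \<delta>" and line: "\<And>t. \<bar>t\<bar> < \<delta> \<Longrightarrow> x + t *\<^sub>R e x \<in> U"
  shows "\<delta> \<le> norm (V x)"
proof (rule ccontr)
  assume less: "\<not> \<delta> \<le> norm (V x)"
  have x: "x \<in> U" using line[of 0] \<delta> by simp
  obtain k where k: "\<And>t. - \<delta> < t \<Longrightarrow> t < \<delta> \<Longrightarrow> 0 < 1 + k * t \<and>
    norm (V (x + t *\<^sub>R e x)) * (1 + k * t) = norm (V x) + 2 * t + k * t\<^sup>2"
    by (rule V_on_line[OF x _ \<delta>, of "- \<delta>"]) (use \<delta> line in \<open>auto simp: abs_less_iff\<close>)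
  define \<tau> where "\<tau> = (norm (V x) + \<delta>) / 2"
  have \<tau>: "norm (V x) < \<tau>" "0 < \<tau>" "\<tau> < \<delta>"
    using less \<delta> by (simp_all add: \<tau>_def field_simps add_pos_nonneg)
  have k': "0 < 1 + k * (- \<tau>)"
    "norm (V (x + (- \<tau>) *\<^sub>R e x)) * (1 + k * (- \<tau>)) = norm (V x) + 2 * (- \<tau>) + k * (- \<tau>)\<^sup>2"
    using k[of "- \<tau>"] \<tau> by auto
  have "0 \<le> norm (V (x + (- \<tau>) *\<^sub>R e x)) * (1 + k * (- \<tau>))" using k'(1) by (intro mult_nonneg_nonneg) auto
  then have 1: "0 \<le> norm (V x) - 2 * \<tau> + k * \<tau>\<^sup>2" using k'(2) by simp
  have "0 < \<tau> * (1 + k * (- \<tau>))" using k'(1) \<tau> by simp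
  then have "k * \<tau>\<^sup>2 < \<tau>" by (simp add: algebra_simps power2_eq_square)
  then show False using 1 \<tau> by linarith
qed

section \<open>Points whose line, followed against \<open>e\<close>, ends in a given part of
  \<open>S\<close>\<close>

definition reach :: "(real^2) set \<Rightarrow> (real^2) set" where
  "reach A = {x \<in> U. \<exists>T>0. x - T *\<^sub>R e x \<in> A \<and> (\<forall>t. 0 \<le> t \<and> t < T \<longrightarrow> x - t *\<^sub>R e x \<in> U)}"

text \<open>Both hitting times are the first time at which the backward line leaves
  \<open>U\<close>, so they coincide and so do the points hit.\<close>

lemma reach_disjoint:
  assumes "A \<subseteq> S" "B \<subseteq> S" "A \<inter> B = {}"
  shows "reach A \<inter> reach B = {}"
proof (rule ccontr)
  assume "reach A \<inter> reach B \<noteq> {}"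
  then obtain x where "x \<in> reach A" "x \<in> reach B" by blast
  then obtain T1 T2 where
    1: "T1 > 0" "x - T1 *\<^sub>R e x \<in> A" "\<And>t. 0 \<le> t \<Longrightarrow> t < T1 \<Longrightarrow> x - t *\<^sub>R e x \<in> U" and
    2: "T2 > 0" "x - T2 *\<^sub>R e x \<in> B" "\<And>t. 0 \<le> t \<Longrightarrow> t < T2 \<Longrightarrow> x - t *\<^sub>R e x \<in> U"
    by (auto simp: reach_def)
  have "x - T1 *\<^sub>R e x \<notin> U" "x - T2 *\<^sub>R e x \<notin> U" using 1 2 assms by (auto simp: U_iff)
  then have "T1 = T2" using 1(3)[of T2] 2(3)[of T1] 1(1) 2(1) by linarith
  then show False using 1 2 assms by auto
qed

lemma reach_forward:
  assumes h: "0 \<le> h" and seg: "\<And>s. 0 \<le> s \<Longrightarrow> s \<le> h \<Longrightarrow> y - s *\<^sub>R e y \<in> U"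
    and r: "y - h *\<^sub>R e y \<in> reach A"
  shows "y \<in> reach A"
proof -
  have "e (y + (- h) *\<^sub>R e y) = e y"
  proof (rule e_const)
    fix s assume "s \<in> closed_segment 0 (- h)"
    then have "- h \<le> s" "s \<le> 0" using h by (auto simp: closed_segment_eq_real_ivl split: if_splits)
    then show "y + s *\<^sub>R e y \<in> U" using seg[of "- s"] by simp
  qed
  then have eh: "e (y - h *\<^sub>R e y) = e y" by simp
  obtain T where T: "T > 0" "y - h *\<^sub>R e y - T *\<^sub>R e y \<in> A"
    "\<And>t. 0 \<le> t \<Longrightarrow> t < T \<Longrightarrow> y - h *\<^sub>R e y - t *\<^sub>R e y \<in> U"
    using r by (auto simp: reach_def eh)
  have "y - (h + T) *\<^sub>R e y \<in> A" using T(2) by (simp add: algebra_simps)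
  moreover have "y - t *\<^sub>R e y \<in> U" if "0 \<le> t" "t < h + T" for t
    using seg[of t] T(3)[of "t - h"] that by (cases "t \<le> h") (auto simp: algebra_simps)
  moreover have "y \<in> U" using seg[of 0] h by simp
  ultimately show ?thesis using T(1) h by (auto simp: reach_def intro!: exI[of _ "h + T"])
qed

text \<open>The hitting times are bounded by the size of \<Omega>, so a subsequence converges and
  the limit line meets \<open>A\<close>. It cannot meet \<open>S\<close> earlier: by
  \<open>backward_end_bound\<close>, |V| along the approximating lines is at least the remaining
  time, and this passes to the limit.\<close>

lemma reach_closed:
  assumes A: "closed A" "A \<subseteq> S" and f: "\<And>n. f n \<in> reach A" "f \<longlonglongrightarrow> x" and x: "x \<in> U"
  shows "x \<in> reach A"
proof -
  have "\<forall>n. \<exists>T>0. f n - T *\<^sub>R e (f n) \<in> A \<and> (\<forall>t. 0 \<le> t \<and> t < T \<longrightarrow> f n - t *\<^sub>R e (f n) \<in> U)"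
    using f(1) by (auto simp: reach_def)
  then obtain T where T: "\<And>n. T n > 0" "\<And>n. f n - T n *\<^sub>R e (f n) \<in> A"
    "\<And>n t. 0 \<le> t \<Longrightarrow> t < T n \<Longrightarrow> f n - t *\<^sub>R e (f n) \<in> U" by metis
  have fU: "f n \<in> U" for n using f(1) by (auto simp: reach_def)
  obtain M where M: "\<And>y. y \<in> \<Omega> \<Longrightarrow> norm y \<le> M" using bounded_dom by (auto simp: bounded_iff)
  have "T n \<in> {0..2 * M}" for n
  proof -
    have "T n = norm (f n - (f n - T n *\<^sub>R e (f n)))" using norm_e[OF fU] T(1)[of n] by simp
    also have "\<dots> \<le> norm (f n) + norm (f n - T n *\<^sub>R e (f n))" by (rule norm_triangle_ineq4)
    also have "\<dots> \<le> M + M" using M fU T(2) A(2) by (intro add_mono) (auto simp: U_iff S_def)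
    finally show ?thesis using T(1)[of n] by simp
  qed
  then obtain r \<tau> where r: "strict_mono r" "(T \<circ> r) \<longlonglongrightarrow> \<tau>"
    using compact_Icc[of 0 "2 * M"] unfolding compact_def by metis
  have Tr: "(\<lambda>n. T (r n)) \<longlonglongrightarrow> \<tau>" using r(2) by (simp add: o_def)
  have fr: "(\<lambda>n. f (r n)) \<longlonglongrightarrow> x" using LIMSEQ_subseq_LIMSEQ[OF f(2) r(1)] by (simp add: o_def)
  have er: "(\<lambda>n. e (f (r n))) \<longlonglongrightarrow> e x" by (rule e_tendsto[OF fr x])
  have a: "x - \<tau> *\<^sub>R e x \<in> A"
    by (rule closed_sequentially[OF A(1)]) (use T(2) in \<open>auto intro!: tendsto_intros fr Tr er\<close>)
  have "\<tau> \<ge> 0" by (rule tendsto_lowerbound[OF Tr]) (auto intro!: always_eventually less_imp_le T(1))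
  moreover have "\<tau> \<noteq> 0" using a A(2) x by (auto simp: U_iff)
  ultimately have \<tau>: "\<tau> > 0" by simp
  have "x - t *\<^sub>R e x \<in> U" if t: "0 \<le> t" "t < \<tau>" for t
  proof -
    \<comment> \<open>Convexity of \<Omega> keeps the limit segment inside \<Omega>.\<close>
    have "(1 - t / \<tau>) *\<^sub>R x + (t / \<tau>) *\<^sub>R (x - \<tau> *\<^sub>R e x) \<in> \<Omega>"
      using convex_dom x a A(2) S_sub t \<tau> by (intro convexD) (auto simp: U_iff)
    then have in\<Omega>: "x - t *\<^sub>R e x \<in> \<Omega>" using \<tau> by (simp add: algebra_simps)
    have lim: "(\<lambda>n. norm (V (f (r n) - t *\<^sub>R e (f (r n))))) \<longlonglongrightarrow> norm (V (x - t *\<^sub>R e x))"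
      by (intro tendsto_norm V_tendsto in\<Omega> tendsto_intros fr er)
    have "\<forall>\<^sub>F n in sequentially. T (r n) - t \<le> norm (V (f (r n) - t *\<^sub>R e (f (r n))))"
      using order_tendstoD(1)[OF Tr t(2)]
    proof eventually_elim
      case (elim n)
      let ?y = "f (r n) - t *\<^sub>R e (f (r n))"
      have "e (f (r n) + (- t) *\<^sub>R e (f (r n))) = e (f (r n))"
      proof (rule e_const)
        fix s assume "s \<in> closed_segment 0 (- t)"
        then have "- t \<le> s" "s \<le> 0" using t by (auto simp: closed_segment_eq_real_ivl split: if_splits)
        then show "f (r n) + s *\<^sub>R e (f (r n)) \<in> U" using T(3)[of "- s" "r n"] elim by simp
      qed
      then have ey: "e ?y = e (f (r n))" by simp
      have shift: "?y - s *\<^sub>R e ?y = f (r n) - (t + s) *\<^sub>R e (f (r n))" for s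
        unfolding ey by (simp add: algebra_simps)
      show ?case
      proof (rule backward_end_bound)
        show "?y \<in> U" using T(3)[OF t(1) elim] .
        show "?y - s *\<^sub>R e ?y \<in> U" if "0 \<le> s" "s < T (r n) - t" for s
          unfolding shift using that t by (intro T(3)) auto
        show "?y - (T (r n) - t) *\<^sub>R e ?y \<in> S" unfolding shift using T(2) A(2) by auto
      qed (use elim in simp)
    qed
    then have "\<tau> - t \<le> norm (V (x - t *\<^sub>R e x))"
      using tendsto_le[OF sequentially_bot lim tendsto_diff[OF Tr tendsto_const[of t]]] by simp
    then show ?thesis using t in\<Omega> by (auto simp: U_def)
  qed
  then show ?thesis using x \<tau> a by (auto simp: reach_def)
qed

text \<open>The forward line cannot leave \<open>U\<close> within the length \<delta>, since the
  exit point would be near \<open>a\<close>, hence in \<Omega> and singular. If the backward line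
  also stayed that long, \<open>long_line_bound\<close> would force |V y| \<ge> \<delta>. So it
  leaves early, at a point near \<open>a\<close>, which must lie in \<open>A\<close>.\<close>

lemma near_reach:
  assumes \<delta>: "0 < \<delta>" and a: "a \<in> A" and sep: "\<And>z. dist z a < 3 * \<delta> \<Longrightarrow> z \<in> \<Omega> \<and> z \<notin> B"
    and AB: "A \<union> B = S" and y: "y \<in> U" "dist y a < \<delta>" "norm (V y) < \<delta>"
  shows "y \<in> reach A"
proof -
  obtain T where T: "T > 0" "\<And>t. 0 \<le> t \<Longrightarrow> t < T \<Longrightarrow> y + t *\<^sub>R (- e y) \<in> U" "y + T *\<^sub>R (- e y) \<notin> U"
    by (rule ray_exit[OF open_U bounded_U y(1), of "- e y"]) (use norm_e y in auto)
  obtain T' where T': "T' > 0" "\<And>t. 0 \<le> t \<Longrightarrow> t < T' \<Longrightarrow> y + t *\<^sub>R e y \<in> U" "y + T' *\<^sub>R e y \<notin> U"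
    by (rule ray_exit[OF open_U bounded_U y(1), of "e y"]) (use norm_e y in auto)
  have "\<delta> \<le> T'"
  proof (rule ccontr)
    assume "\<not> \<delta> \<le> T'"
    then have "dist (y + T' *\<^sub>R e y) a < 3 * \<delta>"
      using dist_triangle[of "y + T' *\<^sub>R e y" a y] norm_e[OF y(1)] y(2) T'(1) by (simp add: dist_norm)
    then have "y + T' *\<^sub>R e y \<in> S" using T'(3) sep by (auto simp: U_iff)
    then show False using forward_end_notin_S[OF y(1) T'(1,2)] by simp
  qed
  have "T < \<delta>"
  proof (rule ccontr)
    assume "\<not> T < \<delta>"
    then have "y + t *\<^sub>R e y \<in> U" if "\<bar>t\<bar> < \<delta>" for t
      using that T(2)[of "- t"] T'(2)[of t] \<open>\<delta> \<le> T'\<close> by (cases "t \<ge> 0") auto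
    from long_line_bound[OF \<delta> this] y(3) show False by simp
  qed
  then have "dist (y - T *\<^sub>R e y) a < 3 * \<delta>"
    using dist_triangle[of "y - T *\<^sub>R e y" a y] norm_e[OF y(1)] y(2) T(1) by (simp add: dist_norm)
  then have "y - T *\<^sub>R e y \<in> A" using T(3) sep AB by (auto simp: U_iff)
  then show ?thesis using y(1) T by (auto simp: reach_def intro!: exI[of _ T])
qed

text \<open>The factor 3 leaves room for a point at distance below \<delta> from \<open>a\<close>
  and a further step of length below \<delta>.\<close>

lemma separation_radius:
  assumes "compact A" "closed B" "A \<subseteq> \<Omega>" "A \<inter> B = {}"
  obtains \<delta> where "\<delta> > 0" "\<And>a z. a \<in> A \<Longrightarrow> dist z a < 3 * \<delta> \<Longrightarrow> z \<in> \<Omega> \<and> z \<notin> B"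
proof -
  have "closed (B \<union> - \<Omega>)" using assms(2) open_dom by auto
  moreover have "A \<inter> (B \<union> - \<Omega>) = {}" using assms by auto
  ultimately obtain d where d: "d > 0" "\<forall>a\<in>A. \<forall>z\<in>B \<union> - \<Omega>. d \<le> dist a z"
    using separate_compact_closed[OF assms(1)] by metis
  show thesis
    by (rule that[of "d / 3"]) (use d in \<open>auto simp: dist_commute not_le[symmetric]\<close>)
qed

text \<open>Follow the line of \<open>x\<close> back to shortly before its impact. Lines of nearby
  points stay in \<open>U\<close> that long and arrive where \<open>near_reach\<close> applies;
  \<open>reach_forward\<close> carries the conclusion back to their starting points.\<close>

lemma reach_open:
  assumes A: "compact A" "closed B" "A \<union> B = S" "A \<inter> B = {}"
  shows "open (reach A)"
  unfolding open_subopen[of "reach A"]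
proof
  fix x assume xr: "x \<in> reach A"
  have AO: "A \<subseteq> \<Omega>" using A S_sub by auto
  obtain \<delta> where \<delta>: "\<delta> > 0" "\<And>a z. a \<in> A \<Longrightarrow> dist z a < 3 * \<delta> \<Longrightarrow> z \<in> \<Omega> \<and> z \<notin> B"
    using separation_radius[OF A(1,2) AO A(4)] by blast
  have x: "x \<in> U" using xr by (simp add: reach_def)
  obtain T where T: "T > 0" "x - T *\<^sub>R e x \<in> A" "\<And>t. 0 \<le> t \<Longrightarrow> t < T \<Longrightarrow> x - t *\<^sub>R e x \<in> U"
    using xr by (auto simp: reach_def)
  define a where "a = x - T *\<^sub>R e x"
  have aS: "a \<in> \<Omega>" "V a = 0" using T(2) A S_def by (auto simp: a_def)
  have Va: "isCont V a" using V_cont aS(1) open_dom continuous_on_eq_continuous_at by blast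
  then obtain \<eta> where \<eta>: "\<eta> > 0" "\<And>y. dist y a < \<eta> \<Longrightarrow> norm (V y) < \<delta>"
    using \<delta>(1) aS(2) unfolding continuous_at_eps_delta by (metis dist_0_norm dist_commute)
  \<comment> \<open>The stopping time lies strictly before \<open>T\<close>, with remaining length
    below both radii.\<close>
  define h where "h = T - min (T / 2) (min \<delta> \<eta> / 2)"
  have h: "0 \<le> h" "h < T" "T - h < \<delta>" "T - h < \<eta>"
    using T(1) \<delta>(1) \<eta>(1) unfolding h_def by (auto simp: min_def)
  have h_dist: "dist (x - h *\<^sub>R e x) a = T - h"
  proof -
    have "(x - h *\<^sub>R e x) - a = (T - h) *\<^sub>R e x" by (simp add: a_def algebra_simps)
    then show ?thesis using norm_e[OF x] h by (simp add: dist_norm)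
  qed
  have "\<forall>\<^sub>F y in nhds x. \<forall>t\<in>{- h..0}. y + t *\<^sub>R e y \<in> U"
    by (rule line_stable) (use h T(3)[of "- _"] in auto)
  moreover have "\<forall>\<^sub>F y in nhds x. dist (y - h *\<^sub>R e y) a < min \<delta> \<eta>"
  proof -
    have "isCont e x" using e_cont x open_U continuous_on_eq_continuous_at by blast
    then have "isCont (\<lambda>y. dist (y - h *\<^sub>R e y) a) x" by (intro continuous_intros)
    then have "((\<lambda>y. dist (y - h *\<^sub>R e y) a) \<longlongrightarrow> dist (x - h *\<^sub>R e x) a) (nhds x)"
      unfolding isCont_def by (rule tendsto_at_iff_tendsto_nhds[THEN iffD1])
    then show ?thesis by (rule order_tendstoD) (use h_dist h in simp)
  qed
  ultimately have "\<forall>\<^sub>F y in nhds x. y \<in> reach A"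
  proof eventually_elim
    case (elim y)
    have seg: "y - s *\<^sub>R e y \<in> U" if "0 \<le> s" "s \<le> h" for s
      using bspec[OF elim(1), of "- s"] that by simp
    have "y - h *\<^sub>R e y \<in> reach A"
    proof (rule near_reach[OF \<delta>(1) _ _ A(3)])
      show "a \<in> A" using T(2) by (simp add: a_def)
      then show "z \<in> \<Omega> \<and> z \<notin> B" if "dist z a < 3 * \<delta>" for z using \<delta>(2) that by blast
    qed (use seg h \<eta>(2) elim(2) in auto)
    then show ?case using reach_forward[OF h(1) seg] by blast
  qed
  then show "\<exists>T. open T \<and> x \<in> T \<and> T \<subseteq> reach A"
    unfolding eventually_nhds by blast
qed

text \<open>A nonempty compact set has a frontier point, and arbitrarily near it there are points
  outside \<open>A\<close>. Those close enough lie in \<open>U\<close>, have small \<open>V\<close>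
  and satisfy \<open>near_reach\<close>.\<close>

lemma reach_nonempty:
  assumes A: "compact A" "closed B" "A \<union> B = S" "A \<inter> B = {}" "A \<noteq> {}"
  shows "reach A \<noteq> {}"
proof -
  have AO: "A \<subseteq> \<Omega>" using A S_sub by auto
  obtain \<delta> where \<delta>: "\<delta> > 0" "\<And>a z. a \<in> A \<Longrightarrow> dist z a < 3 * \<delta> \<Longrightarrow> z \<in> \<Omega> \<and> z \<notin> B"
    using separation_radius[OF A(1,2) AO A(4)] by blast
  have "A \<noteq> UNIV" using A(1) not_compact_UNIV by blast
  then have "frontier A \<noteq> {}" using A(5) frontier_eq_empty by blast
  then obtain a where af: "a \<in> frontier A" by blast
  then have a: "a \<in> A" using A(1) compact_imp_closed frontier_subset_closed by blast
  then have aS: "a \<in> \<Omega>" "V a = 0" using A S_def by auto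
  have "isCont V a" using V_cont aS(1) open_dom continuous_on_eq_continuous_at by blast
  then obtain \<eta> where \<eta>: "\<eta> > 0" "\<And>y. dist y a < \<eta> \<Longrightarrow> norm (V y) < \<delta>"
    using \<delta>(1) aS(2) unfolding continuous_at_eps_delta by (metis dist_0_norm dist_commute)
  have "min \<delta> \<eta> > 0" using \<delta> \<eta> by simp
  then obtain y where y: "y \<notin> A" "dist a y < min \<delta> \<eta>"
    using af unfolding frontier_straddle by blast
  have yd: "dist y a < \<delta>" "dist y a < \<eta>" using y(2) by (auto simp: dist_commute)
  have yO: "y \<in> \<Omega> \<and> y \<notin> B" by (rule \<delta>(2)[OF a]) (use yd \<delta>(1) in linarith)
  have "y \<in> reach A"
  proof (rule near_reach[OF \<delta>(1) a _ A(3)])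
    show "z \<in> \<Omega> \<and> z \<notin> B" if "dist z a < 3 * \<delta>" for z using \<delta>(2)[OF a that] .
    show "y \<in> U" using yO y(1) A(3) by (auto simp: U_iff)
  qed (use yd \<eta> in auto)
  then show ?thesis by blast
qed

text \<open>The forward line leaves \<open>U\<close> at a point that is not singular, hence outside
  \<Omega> and so outside \<open>K\<close>. Shortly before that it is still in \<Omega> but already
  outside \<open>K\<close>.\<close>

lemma reach_collar:
  assumes x: "x \<in> reach A" and K: "compact K" "K \<subseteq> \<Omega>"
  shows "reach A \<inter> (\<Omega> - K) \<noteq> {}"
proof -
  have xU: "x \<in> U" using x by (simp add: reach_def)
  obtain T where T: "T > 0" "\<And>t. 0 \<le> t \<Longrightarrow> t < T \<Longrightarrow> x + t *\<^sub>R e x \<in> U" "x + T *\<^sub>R e x \<notin> U"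
    by (rule ray_exit[OF open_U bounded_U xU, of "e x"]) (use norm_e xU in auto)
  have "x + T *\<^sub>R e x \<notin> S" by (rule forward_end_notin_S[OF xU T(1,2)])
  then have "x + T *\<^sub>R e x \<in> - K" using T(3) K by (auto simp: U_iff)
  moreover have "open (- K)" using K compact_imp_closed by auto
  ultimately obtain d where d: "d > 0" "ball (x + T *\<^sub>R e x) d \<subseteq> - K"
    using open_contains_ball by blast
  define h where "h = T - min T (d / 2)"
  have h: "0 \<le> h" "h < T" "T - h < d" using T(1) d(1) by (auto simp: h_def min_def)
  let ?y = "x + h *\<^sub>R e x"
  have "(x + T *\<^sub>R e x) - ?y = (T - h) *\<^sub>R e x" by (simp add: algebra_simps)
  then have "dist (x + T *\<^sub>R e x) ?y = T - h" using norm_e[OF xU] h by (simp add: dist_norm)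
  then have "?y \<in> ball (x + T *\<^sub>R e x) d" unfolding mem_ball using h by simp
  then have "?y \<notin> K" using d(2) by blast
  moreover have yU: "?y \<in> U" using T(2) h by auto
  moreover have "?y \<in> reach A"
  proof (rule reach_forward[OF h(1)])
    have ey: "e ?y = e x"
      by (rule e_const) (use T(2) h in \<open>auto simp: closed_segment_eq_real_ivl\<close>)
    show "?y - s *\<^sub>R e ?y \<in> U" if "0 \<le> s" "s \<le> h" for s
    proof -
      have eq: "?y - s *\<^sub>R e ?y = x + (h - s) *\<^sub>R e x" unfolding ey by (simp add: algebra_simps)
      show ?thesis unfolding eq by (rule T(2)) (use that h in auto)
    qed
    show "?y - h *\<^sub>R e ?y \<in> reach A" unfolding ey using x by simp
  qed
  ultimately show ?thesis by (auto simp: U_iff)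
qed

lemma connected_S:
  assumes cS: "compact S"
  shows "connected S"
proof (rule ccontr)
  assume "\<not> connected S"
  then obtain A B where AB: "closed A" "closed B" "A \<noteq> {}" "B \<noteq> {}" "A \<union> B = S" "A \<inter> B = {}"
    using connected_closed_set[OF compact_imp_closed[OF cS]] by blast
  have cA: "compact A" and cB: "compact B"
    using AB cS by (metis compact_Int_closed Un_Int_eq(1) Int_commute, metis compact_Int_closed Un_Int_eq(2) Int_commute)
  have BA: "B \<union> A = S" "B \<inter> A = {}" using AB by auto
  \<comment> \<open>Convexity of \<Omega> keeps the hull inside \<Omega>. Removing it leaves a
    connected set of regular points.\<close>
  define K where "K = convex hull S"
  have K: "compact K" "convex K" "K \<subseteq> \<Omega>" "S \<subseteq> K"
    using cS S_sub convex_dom by (auto simp: K_def compact_convex_hull hull_minimal hull_subset)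
  have "K \<noteq> {}" using K(4) AB by auto
  then have C: "connected (\<Omega> - K)"
    by (intro connected_diff_convex open_dom convex_dom K) auto
  \<comment> \<open>The trace on the connected set \<Omega> - K is nonempty, open and closed, so it
    is everything. The statement is symmetric in the two parts and is applied to each.\<close>
  have all: "\<Omega> - K \<subseteq> reach P"
    if P: "compact P" "closed Q" "P \<union> Q = S" "P \<inter> Q = {}" "P \<noteq> {}" for P Q
  proof -
    have "openin (top_of_set (\<Omega> - K)) ((\<Omega> - K) \<inter> reach P)"
      using reach_open[OF P(1-4)] by (rule openin_open_Int)
    moreover have "closedin (top_of_set (\<Omega> - K)) ((\<Omega> - K) \<inter> reach P)"
      unfolding closedin_limpt islimpt_sequential
    proof (intro conjI allI impI)
      fix x assume "(\<exists>f. (\<forall>n. f n \<in> (\<Omega> - K) \<inter> reach P - {x}) \<and> f \<longlonglongrightarrow> x) \<and> x \<in> \<Omega> - K"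
      then obtain f where f: "\<And>n. f n \<in> reach P" "f \<longlonglongrightarrow> x" and x: "x \<in> \<Omega> - K" by blast
      have "x \<in> U" using K(4) x by (auto simp: U_iff)
      then have "x \<in> reach P"
        using reach_closed[OF compact_imp_closed[OF P(1)] _ f] P(3) by blast
      then show "x \<in> (\<Omega> - K) \<inter> reach P" using x by blast
    qed auto
    moreover have "(\<Omega> - K) \<inter> reach P \<noteq> {}"
      using reach_nonempty[OF P] reach_collar[OF _ K(1,3)] by blast
    ultimately have "(\<Omega> - K) \<inter> reach P = \<Omega> - K"
      using C unfolding connected_clopen by blast
    then show ?thesis by blast
  qed
  have "\<Omega> - K \<subseteq> reach A \<inter> reach B"
    using all[OF cA AB(2,5,6,3)] all[OF cB AB(1) BA AB(4)] by blast
  also have "\<dots> = {}" by (rule reach_disjoint) (use AB in auto)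
  finally have "\<Omega> - K = {}" by blast
  then show False
    using reach_nonempty[OF cA AB(2,5,6,3)] reach_collar[OF _ K(1,3)] by blast
qed

end

section \<open>The singular set\<close>

text \<open>This removes the integral over the singular set when the test function is supported in
  the regular set.\<close>

lemma grad_zero_outside_support:
  assumes "x \<notin> closure {x. \<phi> x \<noteq> 0}"
  shows "grad \<phi> x = 0"
proof -
  have "(\<phi> has_derivative (\<lambda>_. 0)) (at x)"
  proof (rule has_derivative_transform_within_open)
    show "((\<lambda>_. 0) has_derivative (\<lambda>_. 0)) (at x)" by (rule has_derivative_const)
    show "open (- closure {x. \<phi> x \<noteq> 0})" by auto
    show "0 = \<phi> y" if "y \<in> - closure {x. \<phi> x \<noteq> 0}" for y
      using that closure_subset[of "{x. \<phi> x \<noteq> 0}"] by auto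
  qed (use assms in simp)
  from grad_eq[OF this] show ?thesis by (simp add: vec_eq_iff)
qed

lemma uminus_derivative:
  fixes \<phi> :: "real^2 \<Rightarrow> real"
  assumes "\<phi> differentiable (at x)"
  shows "(\<lambda>x. - \<phi> x) differentiable (at x)" "grad (\<lambda>x. - \<phi> x) x = - grad \<phi> x"
proof -
  have d: "((\<lambda>x. - \<phi> x) has_derivative (\<lambda>w. - frechet_derivative \<phi> (at x) w)) (at x)"
    using assms by (intro has_derivative_minus) (simp flip: frechet_derivative_works)
  then show "(\<lambda>x. - \<phi> x) differentiable (at x)" unfolding differentiable_def by blast
  show "grad (\<lambda>x. - \<phi> x) x = - grad \<phi> x"
    unfolding grad_eq[OF d] by (simp add: grad_def vec_eq_iff)
qed

lemma Ck_uminus: "Ck k \<phi> \<Longrightarrow> Ck k (\<lambda>x. - \<phi> x)"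
  by (induction k arbitrary: \<phi>) (auto intro: continuous_intros simp: uminus_derivative)

lemma test_function_uminus: "test_function U \<phi> \<Longrightarrow> test_function U (\<lambda>x. - \<phi> x)"
  by (simp add: test_function_def Ck_uminus)

text \<open>At interior points the limit defining the gradient up to the boundary is the gradient
  itself, by continuity of \<open>g\<close>.\<close>

lemma grad_cl_eq:
  assumes \<Omega>: "open \<Omega>" "x \<in> \<Omega>" and g: "continuous_on (closure \<Omega>) g" "\<And>x. x \<in> \<Omega> \<Longrightarrow> g x = grad u x"
  shows "grad_cl \<Omega> u x = grad u x"
proof -
  have "(grad u \<longlongrightarrow> grad u x) (at x)"
  proof -
    have "continuous_on \<Omega> (grad u)"
      using continuous_on_subset[OF g(1) closure_subset] g(2) by (simp cong: continuous_on_cong)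
    then show ?thesis using \<Omega> by (simp add: continuous_on_eq_continuous_at isCont_def)
  qed
  then show ?thesis
    unfolding grad_cl_def at_within_open[OF \<Omega>(2,1)] by (intro tendsto_Lim) auto
qed

theorem corollaryJ:
  fixes \<Omega> :: "(real^2) set" and u :: "real^2 \<Rightarrow> real"
  assumes "domain2 \<Omega>" and "bounded \<Omega>" and "C1_boundary \<Omega>"
    and "C1_closure \<Omega> u"
    and "p_minimal_graph \<Omega> u"
    and "convex \<Omega>"
    and "compact (sing_set \<Omega> u)" and "sing_set \<Omega> u \<subseteq> \<Omega>"
    and "sing_set \<Omega> u \<noteq> {}"
  shows "card (components (sing_set \<Omega> u)) = 1"
proof -
  have \<Omega>: "open \<Omega>" using assms(1) by (simp add: domain2_def)
  obtain g where g: "continuous_on (closure \<Omega>) g" "\<And>x. x \<in> \<Omega> \<Longrightarrow> g x = grad u x"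
    and diff: "\<And>x. x \<in> \<Omega> \<Longrightarrow> u differentiable (at x)"
    using assms(4) by (auto simp: C1_closure_def)
  define U where "U = {x \<in> \<Omega>. grad u x + vecF x \<noteq> 0}"
  \<comment> \<open>The singular set lies in \<Omega> by assumption, so it is described by the
    ordinary gradient.\<close>
  have sing: "sing_set \<Omega> u = {x \<in> \<Omega>. grad u x + vecF x = 0}"
  proof (rule set_eqI)
    fix x
    have gc: "grad_cl \<Omega> u x = grad u x" if "x \<in> \<Omega>" using grad_cl_eq[OF \<Omega> that g] .
    show "x \<in> sing_set \<Omega> u \<longleftrightarrow> x \<in> {x \<in> \<Omega>. grad u x + vecF x = 0}"
    proof (cases "x \<in> \<Omega>")
      case True
      then have "x \<in> closure \<Omega>" using closure_subset by blast
      then show ?thesis using True by (simp add: sing_set_def gc)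
    next
      case False
      then show ?thesis using assms(8) by blast
    qed
  qed
  then have U: "\<Omega> - sing_set \<Omega> u = U" "sing_set \<Omega> u \<inter> U = {}" by (auto simp: U_def)
  have half: "0 \<le> (LINT x|lborel. indicator U x *
        ((1 / norm (grad u x + vecF x)) *\<^sub>R (grad u x + vecF x) \<bullet> grad \<phi> x))"
    if \<phi>: "test_function U \<phi>" for \<phi>
  proof -
    have "test_function \<Omega> \<phi>" using \<phi> by (auto simp: test_function_def U_def)
    then have "0 \<le> (LINT x:(sing_set \<Omega> u \<inter> \<Omega>)|lborel. norm (grad \<phi> x)) +
     (LINT x:(\<Omega> - sing_set \<Omega> u)|lborel.
        ((1 / norm (grad u x + vecF x)) *\<^sub>R (grad u x + vecF x)) \<bullet> grad \<phi> x)"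
      using assms(5) unfolding p_minimal_graph_def by blast
    moreover have "(LINT x:(sing_set \<Omega> u \<inter> \<Omega>)|lborel. norm (grad \<phi> x)) = 0"
    proof -
      have "grad \<phi> x = 0" if "x \<in> sing_set \<Omega> u" for x
        using that \<phi> U(2) by (intro grad_zero_outside_support) (auto simp: test_function_def)
      then have "(\<lambda>x. indicator (sing_set \<Omega> u \<inter> \<Omega>) x *\<^sub>R norm (grad \<phi> x)) = (\<lambda>x. 0)"
        by (auto simp: indicator_def)
      then show ?thesis by (simp add: set_lebesgue_integral_def)
    qed
    ultimately show ?thesis by (simp add: U(1) set_lebesgue_integral_def)
  qed
  interpret p_minimal_convex \<Omega> u
  proof
    show "continuous_on \<Omega> (grad u)"
      using continuous_on_subset[OF g(1) closure_subset] g(2) by (simp cong: continuous_on_cong)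
    fix \<phi> assume "test_function {x \<in> \<Omega>. grad u x + vecF x \<noteq> 0} \<phi>"
    then have \<phi>: "test_function U \<phi>" by (simp add: U_def)
    then have "Ck (Suc 0) \<phi>" unfolding test_function_def by blast
    then have "grad (\<lambda>x. - \<phi> x) x = - grad \<phi> x" for x by (intro uminus_derivative) simp
    note gm = this
    \<comment> \<open>The inequality for the test function and for its negative together give the
      equation.\<close>
    from half[OF \<phi>] half[OF test_function_uminus[OF \<phi>]]
    show "(LINT x|lborel. indicator {x \<in> \<Omega>. grad u x + vecF x \<noteq> 0} x *
        ((1 / norm (grad u x + vecF x)) *\<^sub>R (grad u x + vecF x) \<bullet> grad \<phi> x)) = 0"
      by (simp add: gm flip: U_def)
  qed (use \<Omega> assms diff in auto)
  have "sing_set \<Omega> u = S" by (simp add: sing S_def V_def)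
  then have "connected (sing_set \<Omega> u)" using connected_S assms(7) by simp
  \<comment> \<open>A nonempty connected set is its own single component.\<close>
  then have "components (sing_set \<Omega> u) = {sing_set \<Omega> u}"
    using assms(9) connected_eq_components_subset_sing_exists components_eq_sing_iff by blast
  then show ?thesis by simp
qed

end
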